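(* Let $X$ be a perfect compact metric space which is an ANR or is an $n$-dimensional $LC^{n-1}$-space for some $n\in\mathbb N$. Then: (1) for a generic $f\in C(X,X)$ the set $CR(f)$ is perfect; (2) if $X$ has the weak local periodic point property, then, for any integer $l\ge 2$, for a generic $f\in C(X,X)$ the set $CR(f)$ is perfect and $\overline{Per_l(f)}=CR(f)$.
   Context: For a compact metric space $(X,d)$, $C(X,X)$ is the space of continuous self-maps of $X$ with the topology of uniform convergence. A property holds for a generic $f\in C(X,X)$ if the set of maps having it is residual, i.e. contains a dense $G_\delta$-subset of $C(X,X)$. Perfect means closed without isolated points (for a space: without isolated points). $X$ is $LC^{m}$ if for each $x\in X$ and each neighborhood $U$ of $x$ there is a neighborhood $V\subset U$ of $x$ such that, for $0\le i\le m$, every continuous map from the sphere $S^i$ to $V$ extends to a continuous map from the ball $B^{i+1}$ to $U$. For $f\in C(X,X)$ and $\epsilon>0$, an $\epsilon$-chain for $f$ from $x$ to $y$ is a finite sequence $x=x_0,x_1,\dots,x_n=y$ ($n\ge 1$) in $X$ with $d(f(x_{i-1}),x_i)<\epsilon$ for $i=1,\dots,n$. A point $x$ is chain recurrent for $f$ if for each $\epsilon>0$ there is an $\epsilon$-chain for $f$ from $x$ to $x$; $CR(f)$ is the set of chain recurrent points of $f$. $Per(f)$ is the set of periodic points of $f$, and $Per_l(f)$ is the set of $x\in Per(f)$ whose $f$-orbit has cardinality $\ge l$. $X$ has the weak local periodic point property ($X\in wLPPP$) if there is an open base $\mathcal B$ of $X$ such that, for each $B\in\mathcal B$ and each continuous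 $f:X\to X$ with $f(\overline B)\subset B$, $f$ has a periodic point in $B$. *)

theory Defs
  imports "HOL-Analysis.Analysis"
begin

section \<open>Absolute neighbourhood retracts\<close>

text \<open>
  A metrizable space is an ANR if it is a neighbourhood retract of every metrizable space
  containing it as a closed subspace. HOL cannot quantify over all types inside a definition, so the
  ambient spaces range over all metrizable topologies (on arbitrary carriers) in the type
  \<^typ>\<open>nat \<Rightarrow> real\<close>, which has the cardinality of the continuum; up to homeomorphism this
  covers all separable metrizable spaces. For compact \<open>X\<close> nothing is lost: \<open>X\<close> embeds as a closed
  subset of the countable power of the real line, which is one of the admitted ambient spaces, and
  a neighbourhood retraction there gives one in every metrizable ambient space by Tietze's theorem
  applied coordinatewise.

  The library constant \<^const>\<open>ANR\<close> only admits ambient spaces inside \<^typ>\<open>'a \<times> real\<close>, which is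
  adequate for subsets of Euclidean spaces but not for general metric spaces.
\<close>

definition ANR_space :: "'a topology \<Rightarrow> bool" where
  "ANR_space X \<longleftrightarrow>
     metrizable_space X \<and>
     (\<forall>(Y :: (nat \<Rightarrow> real) topology) S.
        metrizable_space Y \<and> closedin Y S \<and> X homeomorphic_space (subtopology Y S) \<longrightarrow>
        (\<exists>U. openin Y U \<and> S \<subseteq> U \<and> S retract_of_space (subtopology Y U)))"

section \<open>Covering dimension\<close>

definition covering_dim_le :: "'a topology \<Rightarrow> nat \<Rightarrow> bool" where
  "covering_dim_le X n \<longleftrightarrow>
     (\<forall>\<U>. finite \<U> \<and> (\<forall>U\<in>\<U>. openin X U) \<and> \<Union>\<U> = topspace X \<longrightarrow>
        (\<exists>\<V>. finite \<V> \<and> (\<forall>V\<in>\<V>. openin X V) \<and> \<Union>\<V> = topspace X \<and>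
             (\<forall>V\<in>\<V>. \<exists>U\<in>\<U>. V \<subseteq> U) \<and>
             (\<forall>x\<in>topspace X. card {V\<in>\<V>. x \<in> V} \<le> n + 1)))"

definition has_covering_dim :: "'a topology \<Rightarrow> nat \<Rightarrow> bool" where
  "has_covering_dim X n \<longleftrightarrow> covering_dim_le X n \<and> (\<forall>m<n. \<not> covering_dim_le X m)"

section \<open>Local connectedness in higher dimensions\<close>

text \<open>
  \<open>unit_ball_top n\<close> is the closed unit ball of \<open>n\<close>-dimensional Euclidean space, in the encoding
  used by \<^const>\<open>nsphere\<close>; the sphere \<^term>\<open>nsphere i\<close> is the boundary of \<open>unit_ball_top (i + 1)\<close>.
\<close>

definition unit_ball_top :: "nat \<Rightarrow> (nat \<Rightarrow> real) topology" where
  "unit_ball_top n = subtopology (Euclidean_space n) {x. (\<Sum>k<n. (x k)\<^sup>2) \<le> 1}"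

text \<open>
  The index is an integer because the case \<open>m = - 1\<close>, in which the condition is void, occurs for
  zero-dimensional spaces.
\<close>

definition LC_space :: "int \<Rightarrow> 'a topology \<Rightarrow> bool" where
  "LC_space m X \<longleftrightarrow>
     (\<forall>x U. openin X U \<and> x \<in> U \<longrightarrow>
        (\<exists>V. openin X V \<and> x \<in> V \<and> V \<subseteq> U \<and>
           (\<forall>(i::nat) f. int i \<le> m \<and> continuous_map (nsphere i) (subtopology X V) f \<longrightarrow>
              (\<exists>g. continuous_map (unit_ball_top (i + 1)) (subtopology X U) g \<and>
                   (\<forall>y\<in>topspace (nsphere i). g y = f y)))))"

section \<open>Perfect sets and residual sets\<close>

definition perfect_set :: "'a::topological_space set \<Rightarrow> bool" where
  "perfect_set S \<longleftrightarrow> closed S \<and> (\<forall>x\<in>S. \<not> x isolated_in S)"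

definition residual :: "'a::topological_space set \<Rightarrow> bool" where
  "residual A \<longleftrightarrow> (\<exists>G. G \<subseteq> A \<and> gdelta G \<and> closure G = UNIV)"

section \<open>Chain recurrent and periodic points\<close>

definition eps_chain :: "real \<Rightarrow> ('a::metric_space \<Rightarrow> 'a) \<Rightarrow> 'a \<Rightarrow> 'a \<Rightarrow> bool" where
  "eps_chain \<epsilon> f x y \<longleftrightarrow>
     (\<exists>(n::nat) (z :: nat \<Rightarrow> 'a). n \<ge> 1 \<and> z 0 = x \<and> z n = y \<and>
        (\<forall>i\<in>{1..n}. dist (f (z (i - 1))) (z i) < \<epsilon>))"

definition CR :: "('a::metric_space \<Rightarrow> 'a) \<Rightarrow> 'a set" where
  "CR f = {x. \<forall>\<epsilon>>0. eps_chain \<epsilon> f x x}"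

definition Per :: "('a \<Rightarrow> 'a) \<Rightarrow> 'a set" where
  "Per f = {x. \<exists>n\<ge>1. (f ^^ n) x = x}"

definition Per_ge :: "nat \<Rightarrow> ('a \<Rightarrow> 'a) \<Rightarrow> 'a set" where
  "Per_ge l f = {x \<in> Per f. card (range (\<lambda>n. (f ^^ n) x)) \<ge> l}"

definition wLPPP :: "'a::topological_space itself \<Rightarrow> bool" where
  "wLPPP _ \<longleftrightarrow>
     (\<exists>\<B> :: 'a set set. topological_basis \<B> \<and>
        (\<forall>B\<in>\<B>. \<forall>f :: 'a \<Rightarrow> 'a.
           continuous_on UNIV f \<and> f ` closure B \<subseteq> B \<longrightarrow> Per f \<inter> B \<noteq> {}))"

end

theory Submission
  imports Defs
begin

text \<open>
The proof separates the dynamics from the topology of \<open>X\<close>. Besides compactness and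
perfectness, the dynamics needs that \<open>X\<close> is \<^emph>\<open>steerable\<close>: a continuous \<open>f\<close> can be changed by less than \<open>\<epsilon>\<close> so that it becomes
constant near each of finitely many prescribed points, with prescribed constants, as long as these
constants are \<open>\<delta>\<close>-close to the values of \<open>f\<close>; here \<open>\<delta>\<close> depends on \<open>\<epsilon>\<close> but not on the number of
points.

\<^bold>\<open>Dynamics.\<close> Let \<open>x\<close> be chain recurrent and \<open>B\<close> a neighbourhood of \<open>x\<close>. A fine chain from \<open>x\<close> to
itself, traversed several times and moved to pairwise distinct points (\<open>X\<close> is perfect), becomes a
cycle of distinct points with at least two of them in \<open>B\<close>. Steering along this cycle yields a map
\<open>g\<close> near \<open>f\<close> that maps a neighbourhood of every point of the cycle to the next point. Hence some
iterate of \<open>g\<close> maps the closures of two small disjoint open sets in \<open>B\<close> into themselves, and the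
sets do not return to themselves too early (\<open>twin_traps_nearby\<close>). Having such a pair of traps is an
open condition on the map, and each trap contains a chain recurrent point (\<open>CR_meets_trap\<close>) and,
under the weak local periodic point property, a periodic point of large period
(\<open>periodic_point_in_cyclic_trap\<close>). By Baire's theorem, for a generic map every open set that meets
the chain recurrent set contains a pair of traps (\<open>generic_twin_traps\<close>). So no chain recurrent
point is isolated, and periodic points of large period are dense in the chain recurrent set.

\<^bold>\<open>Steering in an ANR.\<close> Embed \<open>X\<close> into the space of real sequences. Straight segments between
nearby points of the image stay in a neighbourhood that retracts onto it, so nearby points of \<open>X\<close>
are joined by small paths that depend continuously on the end points. Pushing \<open>f\<close> along these paths
with a bump function around each prescribed point steers it.

\<^bold>\<open>Steering in an \<open>n\<close>-dimensional \<open>LC\<^sup>n\<^sup>-\<^sup>1\<close> space.\<close> Such a space need not be locally contractible,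
and \<open>f\<close> is replaced by a map that factors through the nerve of a fine open cover of order at most
\<open>n + 1\<close>. The second factor sends every vertex to a value of \<open>f\<close> on the corresponding member of
the cover and is extended over the skeleta of the nerve (\<open>skeleton_realization\<close>): its
simplices have dimension at most \<open>n\<close>, and the \<open>LC\<close> condition fills their boundary spheres with small
discs. The cover is chosen such that every prescribed point
\<open>p\<close> has a neighbourhood meeting a single member \<open>C p\<close> (\<open>separating_cover\<close>). The first factor maps
this neighbourhood to the vertex \<open>C p\<close>, which may be sent to the prescribed value instead.
\<close>

section \<open>Chain recurrent points\<close>

text \<open>
For \<open>n = 1\<close> both ends belong to the same step of the chain, which is why both errors are added.
\<close>
lemma eps_chain_move_ends:
  fixes f :: "'a::metric_space \<Rightarrow> 'a"
  assumes "eps_chain a f x y" and b: "dist (f x') (f x) \<le> b" and c: "dist y y' \<le> c"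
  shows "eps_chain (a + b + c) f x' y'"
proof -
  obtain n :: nat and z where n: "n \<ge> 1" "z 0 = x" "z n = y"
    and z: "\<forall>i\<in>{1..n}. dist (f (z (i - 1))) (z i) < a"
    using assms(1) unfolding eps_chain_def by blast
  have bc: "0 \<le> b" "0 \<le> c"
    using b c zero_le_dist order_trans by blast+
  define z' where "z' = z(0 := x', n := y')"
  have "dist (f (z' (i - 1))) (z' i) < a + b + c" if i: "i \<in> {1..n}" for i
  proof -
    have "dist (f (z' (i - 1))) (f (z (i - 1))) \<le> b"
      using i n b bc by (auto simp: z'_def)
    moreover have "dist (z i) (z' i) \<le> c"
      using i n c bc by (auto simp: z'_def)
    moreover have "dist (f (z' (i - 1))) (z' i) \<le>
        dist (f (z' (i - 1))) (f (z (i - 1))) + (dist (f (z (i - 1))) (z i) + dist (z i) (z' i))"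
      by (meson add_left_mono dist_triangle order_trans)
    ultimately show ?thesis using bspec[OF z i] by linarith
  qed
  moreover have "z' 0 = x'" "z' n = y'" using n by (auto simp: z'_def)
  ultimately show ?thesis unfolding eps_chain_def using n(1) by blast
qed

lemma eps_chain_orbit:
  assumes "n \<ge> 1" "\<epsilon> > 0"
  shows "eps_chain \<epsilon> f x ((f ^^ n) x)"
proof -
  have "dist (f ((f ^^ (i - 1)) x)) ((f ^^ i) x) < \<epsilon>" if "i \<in> {1..n}" for i
  proof -
    obtain k where "i = Suc k" using \<open>i \<in> {1..n}\<close> by (cases i) auto
    then show ?thesis using assms by simp
  qed
  then show ?thesis
    unfolding eps_chain_def using assms
    by (intro exI[of _ n] exI[of _ "\<lambda>i. (f ^^ i) x"]) simp
qed

lemma Per_subset_CR: "Per f \<subseteq> CR f"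
proof
  fix x assume "x \<in> Per f"
  then obtain n where "n \<ge> 1" "(f ^^ n) x = x" unfolding Per_def by blast
  then show "x \<in> CR f" unfolding CR_def using eps_chain_orbit[of n _ f x] by auto
qed

lemma closed_CR:
  assumes "continuous_on UNIV f"
  shows "closed (CR f)"
  unfolding closure_subset_eq[symmetric]
proof
  fix x assume x: "x \<in> closure (CR f)"
  show "x \<in> CR f"
    unfolding CR_def
  proof (safe)
    fix e :: real assume "e > 0"
    then have e3: "e / 3 > 0" by simp
    obtain d where d: "d > 0" "\<And>y. dist y x < d \<Longrightarrow> dist (f y) (f x) < e / 3"
      using assms e3 unfolding continuous_on_iff by (metis UNIV_I)
    have "min d (e/3) > 0" using d e3 by simp
    then obtain y where y: "y \<in> CR f" "dist y x < min d (e/3)"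
      using x unfolding closure_approachable by blast
    have "eps_chain (e / 3) f y y" using y(1) e3 unfolding CR_def by simp
    then have "eps_chain (e/3 + e/3 + e/3) f x x"
      using y d(2)[of y] by (intro eps_chain_move_ends) (auto simp: dist_commute)
    then show "eps_chain e f x x" by simp
  qed
qed

lemma continuous_on_funpow:
  fixes f :: "'a::topological_space \<Rightarrow> 'a"
  assumes "continuous_on UNIV f"
  shows "continuous_on UNIV (f ^^ n)"
proof (induction n)
  case 0
  then show ?case unfolding funpow.simps by (rule continuous_on_id')
next
  case (Suc n)
  then show ?case
    unfolding funpow.simps by (rule continuous_on_compose) (use assms continuous_on_subset in blast)
qed

text \<open>
A limit point \<open>y\<close> of the orbit of a point of \<open>V\<close> under \<open>f ^^ n\<close> lies in the image of the closure of
\<open>V\<close>, hence in \<open>V\<close>. The orbit is near \<open>y\<close> at two different times, so the orbit segment in between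
becomes a chain from \<open>y\<close> to \<open>y\<close> after moving its end points.
\<close>
lemma CR_meets_trap:
  fixes f :: "'a::metric_space \<Rightarrow> 'a"
  assumes "compact (UNIV :: 'a set)" and f: "continuous_on UNIV f"
    and "V \<noteq> {}" "n \<ge> 1" and trap: "(f ^^ n) ` closure V \<subseteq> V"
  shows "CR f \<inter> V \<noteq> {}"
proof -
  define h where "h = f ^^ n"
  define K where "K = h ` closure V"
  have "compact (closure V)" using assms(1) compact_Int_closed[of UNIV "closure V"] by simp
  moreover have "continuous_on (closure V) h"
    unfolding h_def using continuous_on_funpow[OF f] continuous_on_subset by blast
  ultimately have "compact K" unfolding K_def using compact_continuous_image by blast
  have KV: "K \<subseteq> V" using trap unfolding K_def h_def .
  obtain v where "v \<in> V" using \<open>V \<noteq> {}\<close> by blast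
  define u where "u k = (h ^^ Suc k) v" for k
  have uK: "u k \<in> K" for k
  proof (induction k)
    case 0
    then show ?case using \<open>v \<in> V\<close> closure_subset by (auto simp: u_def K_def)
  next
    case (Suc k)
    then show ?case using KV closure_subset by (fastforce simp: u_def K_def)
  qed
  obtain y r where y: "y \<in> K" "strict_mono r" "(u \<circ> r) \<longlonglongrightarrow> y"
    using \<open>compact K\<close> uK unfolding compact_def by metis
  have "y \<in> CR f"
    unfolding CR_def
  proof safe
    fix e :: real assume "e > 0"
    then have e3: "e / 3 > 0" by simp
    obtain d where d: "d > 0" "\<And>x. dist x y < d \<Longrightarrow> dist (f x) (f y) < e / 3"
      using f e3 unfolding continuous_on_iff by (metis UNIV_I)
    have "min d (e/3) > 0" using d e3 by simp
    then obtain N where N: "\<And>k. k \<ge> N \<Longrightarrow> dist ((u \<circ> r) k) y < min d (e/3)"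
      using y(3) unfolding lim_sequentially by blast
    obtain m where m: "r (Suc N) = m + r N" "m \<ge> 1"
      using strict_monoD[OF y(2), of N "Suc N"]
      by (metis add.commute le_add_diff_inverse less_imp_le_nat lessI less_one not_less zero_less_diff)
    have "u (r (Suc N)) = (f ^^ (n * m)) (u (r N))"
      unfolding u_def m(1) add_Suc_right[symmetric] funpow_add comp_def
      by (simp add: h_def funpow_mult)
    moreover have "n * m \<ge> 1" using m \<open>n \<ge> 1\<close> by simp
    ultimately have "eps_chain (e/3) f (u (r N)) (u (r (Suc N)))"
      using eps_chain_orbit e3 by metis
    then have "eps_chain (e/3 + e/3 + e/3) f y y"
      using N[of N] N[of "Suc N"] d(2)[of "u (r N)"]
      by (intro eps_chain_move_ends) (auto simp: dist_commute)
    then show "eps_chain e f y y" by simp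
  qed
  then show ?thesis using y(1) KV by blast
qed

section \<open>The space of continuous self-maps\<close>

lemma bcontfun_of_continuous:
  fixes f :: "'a::metric_space \<Rightarrow> 'a"
  assumes "compact (UNIV :: 'a set)" "continuous_on UNIV f"
  obtains F :: "'a \<Rightarrow>\<^sub>C 'a" where "apply_bcontfun F = f"
proof -
  have "bounded (range f)"
    using assms compact_imp_bounded bounded_subset by blast
  then have "f \<in> bcontfun"
    using assms(2) unfolding bcontfun_def by simp
  then show ?thesis
    using that[of "Bcontfun f"] Bcontfun_inverse[of f] by simp
qed

text \<open>
Compactness makes \<open>X\<close> complete, which gives pointwise limits of a Cauchy sequence; the Cauchy
condition is uniform in the point, and therefore so is the convergence.
\<close>
lemma complete_self_maps:
  assumes "compact (UNIV :: 'a::metric_space set)"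
  shows "complete (UNIV :: ('a \<Rightarrow>\<^sub>C 'a) set)"
  unfolding complete_def
proof safe
  fix F :: "nat \<Rightarrow> ('a \<Rightarrow>\<^sub>C 'a)"
  assume F: "Cauchy F"
  have uc: "\<exists>N. \<forall>m\<ge>N. \<forall>n\<ge>N. \<forall>x. dist (F m x) (F n x) < e" if "e > 0" for e
    using F that unfolding Cauchy_def by (metis dist_fun_lt_imp_dist_val_lt)
  have "\<exists>l. (\<lambda>n. F n x) \<longlonglongrightarrow> l" for x
  proof -
    have "Cauchy (\<lambda>n. F n x)" unfolding Cauchy_def using uc by metis
    then show ?thesis using compact_imp_complete[OF assms] unfolding complete_def by blast
  qed
  then obtain g where g: "\<And>x. (\<lambda>n. F n x) \<longlonglongrightarrow> g x" by metis
  have "uniform_limit UNIV F g sequentially"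
    unfolding uniform_limit_sequentially_iff
  proof safe
    fix e :: real assume "e > 0"
    then obtain N where N: "\<And>m n x. m \<ge> N \<Longrightarrow> n \<ge> N \<Longrightarrow> dist (F m x) (F n x) < e / 2"
      using uc[of "e/2"] by auto
    have "dist (F m x) (g x) \<le> e / 2" if "m \<ge> N" for m x
    proof (rule tendsto_upperbound)
      show "(\<lambda>n. dist (F m x) (F n x)) \<longlonglongrightarrow> dist (F m x) (g x)" by (intro tendsto_intros g)
      show "\<forall>\<^sub>F n in sequentially. dist (F m x) (F n x) \<le> e / 2"
        using N[OF that] unfolding eventually_sequentially by (meson less_imp_le)
    qed simp
    moreover have "e / 2 < e" using \<open>e > 0\<close> by simp
    ultimately show "\<exists>N. \<forall>n\<ge>N. \<forall>x\<in>UNIV. dist (F n x) (g x) < e"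
      using le_less_trans by blast
  qed
  then obtain l' where "F \<longlonglongrightarrow> l'"
    using uniform_limit_bcontfunE[OF _ sequentially_bot] by blast
  then show "\<exists>l\<in>UNIV. F \<longlonglongrightarrow> l" by blast
qed

lemma residual_Inter_dense_open:
  fixes U :: "nat \<Rightarrow> ('a::metric_space) set"
  assumes "complete (UNIV :: 'a set)" "\<And>n. open (U n)" "\<And>n. closure (U n) = UNIV"
  shows "residual (\<Inter>n. U n)"
proof -
  have "Met_TC.mcomplete TYPE('a)"
    using assms(1) unfolding Met_TC.mcomplete_def complete_def by simp
  then have "euclidean closure_of \<Inter>(range U) = UNIV"
    using Met_TC.metric_Baire_category[of "range U"] assms(2,3) by auto
  moreover have "gdelta (\<Inter>n. U n)" using gdelta.intros assms(2) by blast
  ultimately show ?thesis unfolding residual_def by auto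
qed

lemma residual_mono: "residual A \<Longrightarrow> A \<subseteq> B \<Longrightarrow> residual B"
  unfolding residual_def by (meson order_trans)

lemma tendsto_funpow_bcontfun:
  fixes f :: "'a::metric_space \<Rightarrow>\<^sub>C 'a"
  assumes "F \<longlonglongrightarrow> f" "x \<longlonglongrightarrow> y"
  shows "(\<lambda>k. (apply_bcontfun (F k) ^^ j) (x k)) \<longlonglongrightarrow> (apply_bcontfun f ^^ j) y"
proof (induction j)
  case 0
  then show ?case using assms by simp
next
  case (Suc j)
  define a where "a = (\<lambda>k. (apply_bcontfun (F k) ^^ j) (x k))"
  define b where "b = (apply_bcontfun f ^^ j) y"
  have ab: "a \<longlonglongrightarrow> b" using Suc by (simp add: a_def b_def)
  have "(\<lambda>k. apply_bcontfun f (a k)) \<longlonglongrightarrow> apply_bcontfun f b"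
    using continuous_on_tendsto_compose[OF continuous_on_apply_bcontfun[of UNIV f] ab] by simp
  then have 1: "(\<lambda>k. dist (apply_bcontfun f (a k)) (apply_bcontfun f b)) \<longlonglongrightarrow> 0"
    by (subst (asm) tendsto_dist_iff)
  have 2: "(\<lambda>k. dist (F k) f) \<longlonglongrightarrow> 0" using assms(1) by (subst (asm) tendsto_dist_iff)
  have "(\<lambda>k. dist (apply_bcontfun (F k) (a k)) (apply_bcontfun f b)) \<longlonglongrightarrow> 0"
  proof (rule tendsto_sandwich[OF _ _ tendsto_const])
    show "(\<lambda>k. dist (F k) f + dist (apply_bcontfun f (a k)) (apply_bcontfun f b)) \<longlonglongrightarrow> 0"
      using tendsto_add[OF 2 1] by simp
    show "\<forall>\<^sub>F k in sequentially. dist (apply_bcontfun (F k) (a k)) (apply_bcontfun f b)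
        \<le> dist (F k) f + dist (apply_bcontfun f (a k)) (apply_bcontfun f b)"
      by (intro always_eventually allI order_trans[OF dist_triangle add_right_mono[OF dist_bounded]])
  qed simp
  then show ?case unfolding a_def b_def funpow.simps comp_def by (subst tendsto_dist_iff)
qed

lemma open_funpow_image_subset:
  assumes "compact (UNIV :: 'a::metric_space set)" "closed K" "open W"
  shows "open {f :: 'a \<Rightarrow>\<^sub>C 'a. (apply_bcontfun f ^^ j) ` K \<subseteq> W}"
proof -
  have "compact K" using assms(1,2) compact_Int_closed[of UNIV K] by simp
  define S where "S = - {f :: 'a \<Rightarrow>\<^sub>C 'a. (apply_bcontfun f ^^ j) ` K \<subseteq> W}"
  have "closed S"
    unfolding closed_sequential_limits
  proof (intro allI impI, elim conjE)
    fix F f assume F: "\<forall>n. F n \<in> S" "F \<longlonglongrightarrow> f"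
    have "\<forall>k. \<exists>x. x \<in> K \<and> (apply_bcontfun (F k) ^^ j) x \<notin> W"
      using F(1) unfolding S_def by blast
    then obtain x where x: "\<And>k. x k \<in> K" "\<And>k. (apply_bcontfun (F k) ^^ j) (x k) \<notin> W" by metis
    obtain y r where y: "y \<in> K" "strict_mono r" "(x \<circ> r) \<longlonglongrightarrow> y"
      using \<open>compact K\<close> x(1) unfolding compact_def by metis
    have "(F \<circ> r) \<longlonglongrightarrow> f" using LIMSEQ_subseq_LIMSEQ[OF F(2) y(2)] .
    then have lim: "(\<lambda>k. (apply_bcontfun ((F \<circ> r) k) ^^ j) ((x \<circ> r) k)) \<longlonglongrightarrow> (apply_bcontfun f ^^ j) y"
      using y(3) by (rule tendsto_funpow_bcontfun)
    have "(apply_bcontfun f ^^ j) y \<in> - W"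
      by (rule closed_sequentially[OF _ _ lim]) (use assms(3) x(2) in \<open>simp_all add: closed_Compl\<close>)
    then show "f \<in> S" using y(1) unfolding S_def by blast
  qed
  then show ?thesis unfolding S_def by (simp add: open_closed)
qed

section \<open>Traps\<close>

text \<open>
The first clause keeps the iterates of \<open>f ^^ n\<close> in \<open>V\<close>; the second one forces an orbit that starts
in \<open>V\<close> to spend the times \<open>1, \<dots>, l - 1\<close> outside. Both are inclusions of the image of a compact set
in an open set, and therefore survive small perturbations of \<open>f\<close>.
\<close>
definition cyclic_trap :: "nat \<Rightarrow> nat \<Rightarrow> ('a::topological_space \<Rightarrow> 'a) \<Rightarrow> 'a set \<Rightarrow> bool" where
  "cyclic_trap l n f V \<longleftrightarrow>
     (f ^^ n) ` closure V \<subseteq> V \<and> (\<forall>j\<in>{0<..<l}. (f ^^ j) ` closure V \<subseteq> - closure V)"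

text \<open>
Two traps are needed because one chain recurrent point in \<open>B\<close> does not prevent it from being
isolated. The traps are taken from \<open>\<B>\<close>, which will be a base whose members carry fixed-point
information.
\<close>
definition twin_traps :: "'a::topological_space set set \<Rightarrow> nat \<Rightarrow> 'a set \<Rightarrow> ('a \<Rightarrow> 'a) \<Rightarrow> bool" where
  "twin_traps \<B> l B f \<longleftrightarrow>
     (\<exists>V\<in>\<B>. \<exists>W\<in>\<B>. \<exists>n\<ge>1. V \<noteq> {} \<and> W \<noteq> {} \<and> V \<subseteq> B \<and> W \<subseteq> B \<and> V \<inter> W = {} \<and>
        cyclic_trap l n f V \<and> cyclic_trap l n f W)"

lemma open_cyclic_trap:
  assumes "compact (UNIV :: 'a::metric_space set)" "open V"
  shows "open {f :: 'a \<Rightarrow>\<^sub>C 'a. cyclic_trap l n (apply_bcontfun f) V}"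
proof -
  have "{f :: 'a \<Rightarrow>\<^sub>C 'a. cyclic_trap l n (apply_bcontfun f) V} =
      {f. (apply_bcontfun f ^^ n) ` closure V \<subseteq> V} \<inter>
      (\<Inter>j\<in>{0<..<l}. {f. (apply_bcontfun f ^^ j) ` closure V \<subseteq> - closure V})"
    unfolding cyclic_trap_def by auto
  also have "open \<dots>"
    by (intro open_Int open_INT ballI open_funpow_image_subset assms open_Compl closed_closure) simp
  finally show ?thesis .
qed

lemma open_twin_traps:
  assumes "compact (UNIV :: 'a::metric_space set)" "\<And>V. V \<in> \<B> \<Longrightarrow> open V"
  shows "open {f :: 'a \<Rightarrow>\<^sub>C 'a. twin_traps \<B> l B (apply_bcontfun f)}"
proof -
  have "open {f :: 'a \<Rightarrow>\<^sub>C 'a. V \<in> \<B> \<and> W \<in> \<B> \<and> n \<ge> 1 \<and> V \<noteq> {} \<and> W \<noteq> {} \<and> V \<subseteq> B \<and> W \<subseteq> B \<and>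
      V \<inter> W = {} \<and> cyclic_trap l n (apply_bcontfun f) V \<and> cyclic_trap l n (apply_bcontfun f) W}"
    for V W n
  proof (cases "V \<in> \<B> \<and> W \<in> \<B>")
    case True
    then show ?thesis
      by (intro open_Collect_conj open_Collect_const open_cyclic_trap assms) auto
  next
    case False
    then have "\<not> (V \<in> \<B> \<and> W \<in> \<B> \<and> R)" for R by blast
    then show ?thesis by (simp only: open_Collect_const)
  qed
  then have "open {f :: 'a \<Rightarrow>\<^sub>C 'a. \<exists>V W n. V \<in> \<B> \<and> W \<in> \<B> \<and> n \<ge> 1 \<and> V \<noteq> {} \<and> W \<noteq> {} \<and> V \<subseteq> B \<and> W \<subseteq> B \<and>
      V \<inter> W = {} \<and> cyclic_trap l n (apply_bcontfun f) V \<and> cyclic_trap l n (apply_bcontfun f) W}"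
    by (intro open_Collect_ex)
  then show ?thesis unfolding twin_traps_def by (simp only: Bex_def ex_simps)
qed

text \<open>
If two of the points \<open>p, f p, \<dots>, (f ^^ (l - 1)) p\<close> coincided, then following the periodic orbit
until it is back at \<open>p\<close> would show that \<open>p\<close> returns to itself at a time below \<open>l\<close>, which the trap
excludes.
\<close>
lemma periodic_point_in_cyclic_trap:
  fixes f :: "'a::topological_space \<Rightarrow> 'a"
  assumes trap: "cyclic_trap l n f V" and "n \<ge> 1" and p: "p \<in> V" "p \<in> Per (f ^^ n)"
  shows "p \<in> Per_ge l f"
proof -
  obtain k where "k \<ge> 1" and k: "((f ^^ n) ^^ k) p = p" using p(2) unfolding Per_def by blast
  define N where "N = n * k"
  have "N \<ge> 1" using \<open>n \<ge> 1\<close> \<open>k \<ge> 1\<close> by (simp add: N_def)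
  have N: "(f ^^ N) p = p" using k by (simp add: N_def funpow_mult)
  have shift: "(f ^^ (N * a + b)) p = (f ^^ b) p" for a b
  proof (induction a)
    case (Suc a)
    have "(f ^^ (N * Suc a + b)) p = (f ^^ (N * a + b)) ((f ^^ N) p)"
      by (metis add.commute add.left_commute comp_apply funpow_add mult_Suc_right)
    then show ?case using Suc N by simp
  qed simp
  have ne: "(f ^^ j) p \<noteq> p" if "0 < j" "j < l" for j
  proof -
    have pV: "p \<in> closure V" using p(1) closure_subset by blast
    have "(f ^^ j) ` closure V \<subseteq> - closure V"
      using trap that unfolding cyclic_trap_def by simp
    then have "(f ^^ j) p \<notin> closure V" using pV by blast
    then show ?thesis using pV by metis
  qed
  have "inj_on (\<lambda>i. (f ^^ i) p) {..<l}"
  proof (rule linorder_inj_onI')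
    fix i j assume ij: "i \<in> {..<l}" "j \<in> {..<l}" "i < j"
    show "(f ^^ i) p \<noteq> (f ^^ j) p"
    proof
      assume eq: "(f ^^ i) p = (f ^^ j) p"
      \<comment> \<open>\<open>b\<close> further steps after time \<open>i\<close> complete a multiple of the period.\<close>
      define b where "b = N * i - i"
      have "i \<le> N * i" using \<open>N \<ge> 1\<close> by simp
      then have b: "b + i = N * i + 0" "b + j = N * i + (j - i)" using ij by (auto simp: b_def)
      have "(f ^^ (b + i)) p = (f ^^ (b + j)) p" using eq by (simp add: funpow_add)
      then have "p = (f ^^ (j - i)) p" unfolding b shift by simp
      then show False using ne[of "j - i"] ij less_imp_diff_less[of j l i] by simp
    qed
  qed
  then have "l = card ((\<lambda>i. (f ^^ i) p) ` {..<l})" by (simp add: card_image)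
  also have "\<dots> \<le> card (range (\<lambda>i. (f ^^ i) p))"
  proof (rule card_mono)
    have "(f ^^ i) p \<in> (\<lambda>i. (f ^^ i) p) ` {..<N}" for i
    proof (rule image_eqI[of _ _ "i mod N"])
      show "(f ^^ i) p = (f ^^ (i mod N)) p"
        using shift[of "i div N" "i mod N"] by (simp only: mult_div_mod_eq)
      show "i mod N \<in> {..<N}" using \<open>N \<ge> 1\<close> by simp
    qed
    then show "finite (range (\<lambda>i. (f ^^ i) p))"
      by (meson finite_imageI finite_lessThan finite_subset image_subsetI)
  qed auto
  finally have "l \<le> card (range (\<lambda>i. (f ^^ i) p))" .
  moreover have "p \<in> Per f" using N \<open>N \<ge> 1\<close> unfolding Per_def by blast
  ultimately show ?thesis unfolding Per_ge_def by blast
qed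

section \<open>Steerable spaces and generic maps\<close>

text \<open>
The value \<open>\<delta>\<close> must not depend on the number of points in \<open>P\<close>: the points come from chains whose
length is only known once \<open>\<delta>\<close> has been chosen.
\<close>

definition steerable :: "'a::metric_space itself \<Rightarrow> bool" where
  "steerable _ \<longleftrightarrow>
     (\<forall>\<epsilon>>0. \<exists>\<delta>>0. \<forall>(f :: 'a \<Rightarrow> 'a) P q.
        continuous_on UNIV f \<and> finite P \<and> (\<forall>p\<in>P. dist (f p) (q p) < \<delta>) \<longrightarrow>
        (\<exists>g. continuous_on UNIV g \<and> (\<forall>x. dist (g x) (f x) < \<epsilon>) \<and>
             (\<forall>p\<in>P. \<exists>W. open W \<and> p \<in> W \<and> (\<forall>x\<in>W. g x = q p))))"

lemma distinct_nearby_points: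
  fixes w :: "nat \<Rightarrow> 'a::metric_space"
  assumes "perfect_set (UNIV :: 'a set)" "\<eta> > 0"
  shows "\<exists>c. inj_on c {..<N} \<and> (\<forall>i<N. dist (c i) (w i) < \<eta>)"
proof (induction N)
  case (Suc N)
  then obtain c where c: "inj_on c {..<N}" "\<And>i. i < N \<Longrightarrow> dist (c i) (w i) < \<eta>" by blast
  have "w N islimpt UNIV"
    using assms(1) unfolding perfect_set_def isolated_in_islimpt_iff by simp
  then have "infinite (ball (w N) \<eta>)"
    using assms(2) by (simp add: islimpt_eq_infinite_ball)
  then obtain y where y: "y \<in> ball (w N) \<eta>" "y \<notin> c ` {..<N}"
    by (meson finite_imageI finite_lessThan finite_subset subsetI)
  have "inj_on (c(N := y)) {..<Suc N}"
    using c(1) y(2) unfolding lessThan_Suc by (auto simp: inj_on_def)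
  moreover have "dist ((c(N := y)) i) (w i) < \<eta>" if "i < Suc N" for i
    using c(2)[of i] y(1) that by (auto simp: dist_commute less_Suc_eq)
  ultimately show ?case by blast
qed simp

text \<open>
The perturbed map \<open>g\<close> runs around a cycle \<open>c 0, \<dots>, c (N - 1)\<close> of distinct points, is constant near
each of them, and so maps a small neighbourhood of \<open>c i\<close> onto \<open>c i\<close> after \<open>N\<close> steps. The cycle
follows \<open>max 2 l\<close> times a chain of length \<open>m\<close> from \<open>x\<close> to \<open>x\<close>: the second tour supplies another
point \<open>c m\<close> near \<open>x\<close>, and \<open>N \<ge> l\<close> rules out early returns.
\<close>
lemma twin_traps_nearby:
  fixes f :: "'a::metric_space \<Rightarrow> 'a"
  assumes cpt: "compact (UNIV :: 'a set)" and perf: "perfect_set (UNIV :: 'a set)"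
    and steer: "steerable TYPE('a)" and basis: "topological_basis \<B>"
    and f: "continuous_on UNIV f" and B: "open B" and x: "x \<in> CR f" "x \<in> B" and "\<epsilon> > 0"
  shows "\<exists>g. continuous_on UNIV g \<and> (\<forall>x. dist (g x) (f x) < \<epsilon>) \<and> twin_traps \<B> l B g"
proof -
  obtain \<delta> where "\<delta> > 0" and \<delta>: "\<And>P q. finite P \<Longrightarrow> (\<And>p. p \<in> P \<Longrightarrow> dist (f p) (q p) < \<delta>) \<Longrightarrow>
      \<exists>g. continuous_on UNIV g \<and> (\<forall>x. dist (g x) (f x) < \<epsilon>) \<and>
             (\<forall>p\<in>P. \<exists>W. open W \<and> p \<in> W \<and> (\<forall>x\<in>W. g x = q p))"
  proof -
    obtain \<delta> where "\<delta> > 0" and \<delta>: "\<forall>(f :: 'a \<Rightarrow> 'a) P q.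
        continuous_on UNIV f \<and> finite P \<and> (\<forall>p\<in>P. dist (f p) (q p) < \<delta>) \<longrightarrow>
        (\<exists>g. continuous_on UNIV g \<and> (\<forall>x. dist (g x) (f x) < \<epsilon>) \<and>
             (\<forall>p\<in>P. \<exists>W. open W \<and> p \<in> W \<and> (\<forall>x\<in>W. g x = q p)))"
      using mp[OF spec[OF steer[unfolded steerable_def], of \<epsilon>] \<open>\<epsilon> > 0\<close>]
      by (elim exE conjE)
    show thesis
      by (rule that[OF \<open>\<delta> > 0\<close>], rule \<delta>[rule_format]) (simp add: f)
  qed
  have d3: "\<delta> / 3 > 0" using \<open>\<delta> > 0\<close> by simp
  obtain \<beta> where \<beta>: "\<beta> > 0" "ball x \<beta> \<subseteq> B" using B x(2) open_contains_ball by blast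
  have "uniformly_continuous_on UNIV f" by (rule compact_uniformly_continuous[OF f cpt])
  then obtain \<eta>0 where \<eta>0: "\<eta>0 > 0" "\<And>a b. dist a b < \<eta>0 \<Longrightarrow> dist (f a) (f b) < \<delta> / 3"
    using d3 unfolding uniformly_continuous_on_def by (metis UNIV_I)
  define \<eta> where "\<eta> = min \<eta>0 (min \<beta> (\<delta> / 3))"
  have "\<eta> > 0" using \<eta>0 \<beta> d3 by (simp add: \<eta>_def)
  obtain m :: nat and z where m: "m \<ge> 1" "z 0 = x" "z m = x"
    and z: "\<forall>i\<in>{1..m}. dist (f (z (i - 1))) (z i) < \<delta> / 3"
    using x(1) d3 unfolding CR_def eps_chain_def by blast
  \<comment> \<open>The chain \<open>z\<close>, traversed periodically.\<close>
  define w where "w i = z (i mod m)" for i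
  have w: "dist (f (w i)) (w (Suc i)) < \<delta> / 3" for i
  proof -
    have "i mod m < m" using m by simp
    then have "Suc (i mod m) \<in> {1..m}" by simp
    from bspec[OF z this] have "dist (f (w i)) (z (Suc (i mod m))) < \<delta> / 3" by (simp add: w_def)
    moreover have "w (Suc i) = z (Suc (i mod m))" using m by (simp add: w_def mod_Suc)
    ultimately show ?thesis by simp
  qed
  define N where "N = m * max 2 l"
  have N: "m < N" "l \<le> N" "N > 0"
  proof -
    show "m < N" using m(1) by (simp add: N_def less_max_iff_disj)
    then show "N > 0" by simp
    have "1 * l \<le> m * max 2 l" using m(1) by (intro mult_le_mono) auto
    then show "l \<le> N" by (simp add: N_def)
  qed
  obtain c where inj: "inj_on c {..<N}" and c: "\<And>i. i < N \<Longrightarrow> dist (c i) (w i) < \<eta>"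
    using distinct_nearby_points[OF perf \<open>\<eta> > 0\<close>] by metis
  define P where "P = c ` {..<N}"
  have "finite P" by (simp add: P_def)
  define q where "q p = c (Suc (inv_into {..<N} c p) mod N)" for p
  have q: "q (c i) = c (Suc i mod N)" if "i < N" for i
    using inv_into_f_f[OF inj] that by (simp add: q_def)
  have "dist (f p) (q p) < \<delta>" if p: "p \<in> P" for p
  proof -
    obtain i where i: "i < N" "p = c i" using p unfolding P_def by blast
    let ?j = "Suc i mod N"
    have "w ?j = w (Suc i)" by (simp add: w_def N_def mod_mod_cancel)
    then have "dist (f (w i)) (w ?j) < \<delta> / 3" using w[of i] by simp
    moreover have "dist (f (c i)) (f (w i)) < \<delta> / 3"
      using c[OF i(1)] \<eta>0(2) by (simp add: \<eta>_def)
    moreover have "dist (w ?j) (c ?j) < \<delta> / 3"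
      using c[of ?j] N(3) by (simp add: \<eta>_def dist_commute)
    moreover have "dist (f (c i)) (c ?j) \<le>
        dist (f (c i)) (f (w i)) + (dist (f (w i)) (w ?j) + dist (w ?j) (c ?j))"
      by (meson add_left_mono dist_triangle order_trans)
    ultimately show ?thesis using q[OF i(1)] i(2) by simp
  qed
  then obtain g where g: "continuous_on UNIV g" "\<And>x. dist (g x) (f x) < \<epsilon>"
    and gP: "\<And>p. p \<in> P \<Longrightarrow> \<exists>W. open W \<and> p \<in> W \<and> (\<forall>x\<in>W. g x = q p)"
    using \<delta>[of P q] \<open>finite P\<close> by blast
  have orbit: "(g ^^ Suc j) y = c ((i + Suc j) mod N)" if "i < N" "g y = c (Suc i mod N)" for i j y
  proof (induction j)
    case 0
    then show ?case using that by simp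
  next
    case (Suc j)
    let ?k = "(i + Suc j) mod N"
    have k: "?k < N" using N(3) by simp
    then have "c ?k \<in> P" unfolding P_def by blast
    then have "g (c ?k) = q (c ?k)" using gP by blast
    then have "g (c ?k) = c (Suc ?k mod N)" using q[OF k] by simp
    then show ?case using Suc by (simp add: mod_Suc_eq)
  qed
  have trap: "\<exists>V\<in>\<B>. c i \<in> V \<and> V \<subseteq> B \<and> V \<subseteq> ball (c i) r \<and> cyclic_trap l N g V"
    if i: "i < N" "c i \<in> B" "r > 0" for i r
  proof -
    have "c i \<in> P" using i(1) unfolding P_def by blast
    obtain W where W: "open W" "c i \<in> W" "\<And>x. x \<in> W \<Longrightarrow> g x = c (Suc i mod N)"
      using gP[OF \<open>c i \<in> P\<close>] unfolding q[OF i(1)] by blast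
    \<comment> \<open>Removing the other points of the cycle makes the orbit leave the trap between the times
      \<open>0\<close> and \<open>N\<close>.\<close>
    have "open (W \<inter> B \<inter> ball (c i) r - (P - {c i}))"
      using W(1) B by (intro open_Diff open_Int open_ball finite_imp_closed) (simp_all add: \<open>finite P\<close>)
    moreover have "c i \<in> W \<inter> B \<inter> ball (c i) r - (P - {c i})" using W i by auto
    ultimately obtain e where e: "e > 0" "cball (c i) e \<subseteq> W \<inter> B \<inter> ball (c i) r - (P - {c i})"
      using open_contains_cball by metis
    obtain V where V: "V \<in> \<B>" "c i \<in> V" "V \<subseteq> ball (c i) e"
      using topological_basisE[OF basis, of "ball (c i) e" "c i"] e(1) by auto
    have "closure V \<subseteq> cball (c i) e"
      using V(3) by (meson ball_subset_cball closed_cball closure_minimal order_trans)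
    then have clV: "closure V \<subseteq> W \<inter> B \<inter> ball (c i) r - (P - {c i})" using e(2) by blast
    have orb: "(g ^^ j) y = c ((i + j) mod N)" if "y \<in> closure V" "j > 0" for y j
    proof -
      obtain j' where "j = Suc j'" using \<open>j > 0\<close> by (cases j) auto
      moreover have "g y = c (Suc i mod N)" using W(3) clV that(1) by blast
      ultimately show ?thesis using orbit \<open>i < N\<close> by blast
    qed
    have "cyclic_trap l N g V"
      unfolding cyclic_trap_def
    proof (intro conjI ballI image_subsetI)
      fix y assume "y \<in> closure V"
      then have "(g ^^ N) y = c i" using orb N(3) i(1) by simp
      then show "(g ^^ N) y \<in> V" using V(2) by simp
    next
      fix j y assume j: "j \<in> {0<..<l}" and "y \<in> closure V"
      then have y: "(g ^^ j) y = c ((i + j) mod N)" using orb by simp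
      have "(i + j) mod N \<noteq> i"
      proof (cases "i + j < N")
        case False
        then have "N \<le> i + j" "i + j - N < i" using j N(2) i(1) by auto
        then show ?thesis using i(1) by (simp add: le_mod_geq)
      qed (use j in auto)
      moreover have "(i + j) mod N < N" using N(3) by simp
      ultimately have "c ((i + j) mod N) \<in> P - {c i}"
        using inj i(1) unfolding P_def inj_on_def by blast
      then show "(g ^^ j) y \<in> - closure V" using y clV by auto
    qed
    moreover have "V \<subseteq> closure V" by (rule closure_subset)
    ultimately show ?thesis using V(1,2) clV by blast
  qed
  have near: "c i \<in> B" if "i = 0 \<or> i = m" for i
  proof -
    have "i < N" "w i = x" using that N m by (auto simp: w_def)
    then have "c i \<in> ball x \<beta>" using c[of i] by (simp add: \<eta>_def dist_commute)
    then show ?thesis using \<beta>(2) by blast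
  qed
  have "c 0 \<noteq> c m" using inj N m(1) by (metis inj_onD lessThan_iff not_one_le_zero)
  define r where "r = dist (c 0) (c m) / 2"
  have "r > 0" using \<open>c 0 \<noteq> c m\<close> by (simp add: r_def)
  obtain V where V: "V \<in> \<B>" "c 0 \<in> V" "V \<subseteq> B" "V \<subseteq> ball (c 0) r" "cyclic_trap l N g V"
    using trap[OF N(3) near[of 0] \<open>r > 0\<close>] by blast
  obtain W where W: "W \<in> \<B>" "c m \<in> W" "W \<subseteq> B" "W \<subseteq> ball (c m) r" "cyclic_trap l N g W"
    using trap[OF N(1) near[of m] \<open>r > 0\<close>] by blast
  have "ball (c 0) r \<inter> ball (c m) r = {}" by (rule disjoint_ballI) (simp add: r_def)
  then have "V \<inter> W = {}" using V W by blast
  moreover have "N \<ge> 1" using N by simp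
  ultimately have "twin_traps \<B> l B g" unfolding twin_traps_def using V W by blast
  then show ?thesis using g by blast
qed

lemma compact_countable_base:
  assumes "compact (UNIV :: 'a::metric_space set)"
  shows "\<exists>B :: nat \<Rightarrow> 'a set. (\<forall>n. open (B n)) \<and>
           (\<forall>W. open W \<longrightarrow> (\<forall>x\<in>W. \<exists>n. x \<in> B n \<and> B n \<subseteq> W))"
proof -
  have "\<exists>K. finite K \<and> (UNIV :: 'a set) \<subseteq> (\<Union>x\<in>K. ball x (inverse (Suc n)))" for n :: nat
  proof -
    have "inverse (real (Suc n)) > 0" by simp
    then show ?thesis
      using seq_compact_imp_totally_bounded[OF compact_imp_seq_compact[OF assms]] by blast
  qed
  then obtain K :: "nat \<Rightarrow> 'a set" where K: "\<And>n. finite (K n)"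
      "\<And>n. UNIV \<subseteq> (\<Union>x\<in>K n. ball x (inverse (Suc n)))"
    by metis
  define \<C> where "\<C> = (\<Union>n. (\<lambda>x. ball x (inverse (Suc n))) ` K n)"
  have "countable \<C>" unfolding \<C>_def by (rule countable_UN) (use K(1) in \<open>simp_all add: countable_finite\<close>)
  moreover have "K 0 \<noteq> {}" using K(2)[of 0] by blast
  then have "\<C> \<noteq> {}" unfolding \<C>_def by blast
  ultimately have range: "range (from_nat_into \<C>) = \<C>" by (rule range_from_nat_into[rotated])
  show ?thesis
  proof (rule exI[of _ "from_nat_into \<C>"], intro conjI allI impI ballI)
    fix n
    have "from_nat_into \<C> n \<in> \<C>" using range by blast
    then show "open (from_nat_into \<C> n)" unfolding \<C>_def by auto
  next
    fix x :: 'a and W assume "open W" "x \<in> W"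
    then obtain e where e: "e > 0" "ball x e \<subseteq> W" using open_contains_ball by blast
    obtain n where n: "inverse (real (Suc n)) < e / 2"
      using reals_Archimedean[of "e / 2"] e(1) by auto
    obtain y where y: "y \<in> K n" "x \<in> ball y (inverse (Suc n))" using K(2)[of n] by blast
    have "ball y (inverse (Suc n)) \<subseteq> ball x e"
    proof
      fix z assume "z \<in> ball y (inverse (Suc n))"
      then have "dist y z < inverse (Suc n)" "dist x y < inverse (Suc n)"
        using y(2) by (simp_all add: dist_commute)
      then show "z \<in> ball x e" using dist_triangle[of x z y] n by simp
    qed
    moreover have "ball y (inverse (Suc n)) \<in> \<C>" using y(1) unfolding \<C>_def by blast
    ultimately show "\<exists>n. x \<in> from_nat_into \<C> n \<and> from_nat_into \<C> n \<subseteq> W"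
      using y(2) e(2) range by (metis (no_types, lifting) imageE order_trans)
  qed
qed

lemma twin_traps_mono:
  assumes "twin_traps \<B> l B f" "B \<subseteq> C"
  shows "twin_traps \<B> l C f"
proof -
  obtain V W n where VW: "V \<in> \<B>" "W \<in> \<B>" "(n::nat) \<ge> 1" "V \<noteq> {}" "W \<noteq> {}" "V \<subseteq> B" "W \<subseteq> B"
      "V \<inter> W = {}" "cyclic_trap l n f V" "cyclic_trap l n f W"
    using assms(1) unfolding twin_traps_def by blast
  show ?thesis
    unfolding twin_traps_def
    by (intro bexI[of _ V] bexI[of _ W] exI[of _ n] conjI order_trans[OF _ \<open>B \<subseteq> C\<close>] VW)
qed

text \<open>
For a fixed basic open set \<open>B n\<close>, the maps in \<open>T n\<close> have twin traps in \<open>B n\<close>, and those in \<open>R n\<close> have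
a chain recurrent point there. The set \<open>T n\<close> is open and its closure contains \<open>R n\<close>, so adding
the exterior of \<open>R n\<close> to it gives an open dense set. A map that lies in all these sets and in \<open>R n\<close>
must lie in \<open>T n\<close>.
\<close>
lemma generic_twin_traps:
  assumes cpt: "compact (UNIV :: 'a::metric_space set)" and perf: "perfect_set (UNIV :: 'a set)"
    and steer: "steerable TYPE('a)" and basis: "topological_basis \<B>"
  shows "residual {f :: 'a \<Rightarrow>\<^sub>C 'a. \<forall>B x. open B \<and> x \<in> CR (apply_bcontfun f) \<inter> B \<longrightarrow>
           twin_traps \<B> l B (apply_bcontfun f)}"
proof -
  obtain B :: "nat \<Rightarrow> 'a set" where B: "\<forall>n. open (B n)"
      "\<forall>W. open W \<longrightarrow> (\<forall>x\<in>W. \<exists>n. x \<in> B n \<and> B n \<subseteq> W)"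
    using compact_countable_base[OF cpt] by blast
  define T where "T n = {f :: 'a \<Rightarrow>\<^sub>C 'a. twin_traps \<B> l (B n) (apply_bcontfun f)}" for n
  define R where "R n = {f :: 'a \<Rightarrow>\<^sub>C 'a. CR (apply_bcontfun f) \<inter> B n \<noteq> {}}" for n
  define U where "U n = T n \<union> - closure (R n)" for n
  have "open (U n)" for n
    unfolding U_def T_def
    by (intro open_Un open_twin_traps cpt open_Compl closed_closure topological_basis_open[OF basis])
  moreover have "closure (U n) = UNIV" for n
  proof -
    have "R n \<subseteq> closure (T n)"
    proof
      fix f assume "f \<in> R n"
      then obtain x where x: "x \<in> CR (apply_bcontfun f)" "x \<in> B n" unfolding R_def by blast
      show "f \<in> closure (T n)"
        unfolding closure_approachable
      proof safe
        fix e :: real assume "e > 0"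
        then have e2: "e / 2 > 0" by simp
        obtain g where g: "continuous_on UNIV g" "\<And>x. dist (g x) (f x) < e / 2" "twin_traps \<B> l (B n) g"
          using twin_traps_nearby[OF cpt perf steer basis continuous_on_apply_bcontfun[of UNIV f] spec[OF B(1)] x e2]
          by metis
        obtain G where G: "apply_bcontfun G = g" using bcontfun_of_continuous[OF cpt g(1)] .
        have "dist G f \<le> e / 2" using g(2) G by (intro dist_bound less_imp_le) simp
        then have "dist G f < e" using \<open>e > 0\<close> by simp
        moreover have "G \<in> T n" using g(3) G by (simp add: T_def)
        ultimately show "\<exists>y\<in>T n. dist y f < e" by blast
      qed
    qed
    then have "closure (R n) \<subseteq> closure (T n)" by (simp add: closure_minimal)
    moreover have "- closure (R n) \<subseteq> closure (- closure (R n))" by (rule closure_subset)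
    ultimately show ?thesis unfolding U_def closure_Un by blast
  qed
  ultimately have "residual (\<Inter>n. U n)"
    by (intro residual_Inter_dense_open complete_self_maps cpt)
  then show ?thesis
  proof (rule residual_mono, intro subsetI CollectI allI impI, elim conjE)
    fix f W x assume f: "f \<in> (\<Inter>n. U n)" and W: "open W" "x \<in> CR (apply_bcontfun f) \<inter> W"
    obtain n where n: "x \<in> B n" "B n \<subseteq> W" using B(2) W by blast
    have "f \<in> R n" using n(1) W(2) unfolding R_def by blast
    then have "f \<in> closure (R n)" using closure_subset by blast
    then have "f \<in> T n" using f unfolding U_def by blast
    then show "twin_traps \<B> l W (apply_bcontfun f)"
      using twin_traps_mono n(2) unfolding T_def by blast
  qed
qed

text \<open>
A neighbourhood isolating a chain recurrent point would contain two disjoint traps, and a chain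
recurrent point in each of them.
\<close>
lemma perfect_CR_if_twin_traps:
  fixes f :: "'a::metric_space \<Rightarrow> 'a"
  assumes cpt: "compact (UNIV :: 'a set)" and f: "continuous_on UNIV f"
    and basis: "topological_basis \<B>"
    and twin: "\<And>B x. open B \<Longrightarrow> x \<in> CR f \<inter> B \<Longrightarrow> twin_traps \<B> l B f"
  shows "perfect_set (CR f)"
  unfolding perfect_set_def
proof (intro conjI ballI notI)
  show "closed (CR f)" by (rule closed_CR[OF f])
  fix x assume "x isolated_in CR f"
  then obtain B where B: "open B" "B \<inter> CR f = {x}" unfolding isolated_in_def by blast
  then have "x \<in> CR f \<inter> B" by blast
  then obtain V W n where VW: "V \<in> \<B>" "W \<in> \<B>" "(n::nat) \<ge> 1" "V \<noteq> {}" "W \<noteq> {}" "V \<subseteq> B" "W \<subseteq> B"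
      "V \<inter> W = {}" "cyclic_trap l n f V" "cyclic_trap l n f W"
    using twin[OF B(1)] unfolding twin_traps_def by blast
  have "CR f \<inter> V \<noteq> {}" "CR f \<inter> W \<noteq> {}"
    using VW CR_meets_trap[OF cpt f] unfolding cyclic_trap_def by simp_all
  moreover have "CR f \<inter> V \<subseteq> {x}" "CR f \<inter> W \<subseteq> {x}" using VW(6,7) B(2) by auto
  ultimately have "x \<in> V \<inter> W" by auto
  then show False using VW(8) by simp
qed

text \<open>
The fixed-point hypothesis, applied to the iterate \<open>f ^^ n\<close> that maps the closure of a trap into the
trap, produces periodic points close to any chain recurrent point.
\<close>
lemma dense_Per_ge_if_twin_traps:
  fixes f :: "'a::metric_space \<Rightarrow> 'a"
  assumes f: "continuous_on UNIV f"
    and fixpt: "\<And>B g. B \<in> \<B> \<Longrightarrow> continuous_on UNIV g \<Longrightarrow> g ` closure B \<subseteq> B \<Longrightarrow> Per g \<inter> B \<noteq> {}"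
    and twin: "\<And>B x. open B \<Longrightarrow> x \<in> CR f \<inter> B \<Longrightarrow> twin_traps \<B> l B f"
  shows "closure (Per_ge l f) = CR f"
proof
  have "Per_ge l f \<subseteq> CR f" using Per_subset_CR[of f] unfolding Per_ge_def by blast
  then show "closure (Per_ge l f) \<subseteq> CR f" using closed_CR[OF f] by (simp add: closure_minimal)
  show "CR f \<subseteq> closure (Per_ge l f)"
  proof
    fix x assume x: "x \<in> CR f"
    show "x \<in> closure (Per_ge l f)"
      unfolding closure_approachable
    proof safe
      fix e :: real assume "e > 0"
      then have "x \<in> CR f \<inter> ball x e" using x by simp
      then obtain V n where V: "V \<in> \<B>" "(n::nat) \<ge> 1" "V \<subseteq> ball x e" "cyclic_trap l n f V"
        using twin[OF open_ball] unfolding twin_traps_def by blast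
      have "Per (f ^^ n) \<inter> V \<noteq> {}"
        using fixpt[OF V(1) continuous_on_funpow[OF f]] V(4) unfolding cyclic_trap_def by blast
      then obtain p where p: "p \<in> V" "p \<in> Per (f ^^ n)" by blast
      then have "p \<in> Per_ge l f" using periodic_point_in_cyclic_trap V by blast
      moreover have "dist p x < e" using p(1) V(3) by (auto simp: dist_commute)
      ultimately show "\<exists>y\<in>Per_ge l f. dist y x < e" by blast
    qed
  qed
qed

lemma generic_CR_of_steerable:
  assumes cpt: "compact (UNIV :: 'a::metric_space set)" and perf: "perfect_set (UNIV :: 'a set)"
    and steer: "steerable TYPE('a)"
  shows "residual {f :: 'a \<Rightarrow>\<^sub>C 'a. perfect_set (CR (apply_bcontfun f))} \<and>
         (wLPPP TYPE('a) \<longrightarrow>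
           (\<forall>l\<ge>2. residual {f :: 'a \<Rightarrow>\<^sub>C 'a.
              perfect_set (CR (apply_bcontfun f)) \<and>
              closure (Per_ge l (apply_bcontfun f)) = CR (apply_bcontfun f)}))"
proof (intro conjI impI allI)
  have basis: "topological_basis (Collect open :: 'a set set)"
    by (rule topological_basisI) auto
  \<comment> \<open>With \<open>l = 0\<close> the condition on early returns is void.\<close>
  show "residual {f :: 'a \<Rightarrow>\<^sub>C 'a. perfect_set (CR (apply_bcontfun f))}"
    by (rule residual_mono[OF generic_twin_traps[OF cpt perf steer basis, of 0]])
       (auto intro!: perfect_CR_if_twin_traps[OF cpt _ basis])
next
  fix l :: nat
  assume "wLPPP TYPE('a)"
  then obtain \<B> :: "'a set set" where basis: "topological_basis \<B>"
    and "\<forall>B\<in>\<B>. \<forall>f :: 'a \<Rightarrow> 'a. continuous_on UNIV f \<and> f ` closure B \<subseteq> B \<longrightarrow> Per f \<inter> B \<noteq> {}"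
    unfolding wLPPP_def by (elim exE conjE)
  then have fixpt: "Per g \<inter> B \<noteq> {}"
    if "B \<in> \<B>" "continuous_on UNIV g" "g ` closure B \<subseteq> B" for B and g :: "'a \<Rightarrow> 'a"
    using that by simp
  show "residual {f :: 'a \<Rightarrow>\<^sub>C 'a. perfect_set (CR (apply_bcontfun f)) \<and>
              closure (Per_ge l (apply_bcontfun f)) = CR (apply_bcontfun f)}"
  proof (rule residual_mono[OF generic_twin_traps[OF cpt perf steer basis, of l]], intro subsetI CollectI)
    fix f :: "'a \<Rightarrow>\<^sub>C 'a"
    assume "f \<in> {f. \<forall>B x. open B \<and> x \<in> CR (apply_bcontfun f) \<inter> B \<longrightarrow> twin_traps \<B> l B (apply_bcontfun f)}"
    then have twin: "twin_traps \<B> l B (apply_bcontfun f)"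
      if "open B" "x \<in> CR (apply_bcontfun f) \<inter> B" for B x
      using that by blast
    show "perfect_set (CR (apply_bcontfun f)) \<and>
        closure (Per_ge l (apply_bcontfun f)) = CR (apply_bcontfun f)"
      using perfect_CR_if_twin_traps[OF cpt _ basis twin] dense_Per_ge_if_twin_traps[OF _ fixpt twin]
      by simp
  qed
qed

section \<open>Absolute neighbourhood retracts are steerable\<close>

lemma finite_disjoint_cballs:
  fixes P :: "'a::metric_space set"
  assumes "finite P"
  shows "\<exists>r>0. \<forall>p\<in>P. \<forall>q\<in>P. p \<noteq> q \<longrightarrow> cball p r \<inter> cball q r = {}"
proof -
  have "\<exists>r>0. \<forall>p\<in>P. \<forall>q\<in>P. p \<noteq> q \<longrightarrow> r \<le> dist p q / 3"
    using assms
  proof (induction P rule: finite_induct)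
    case (insert a P)
    then obtain r where r: "r > 0" "\<And>p q. p \<in> P \<Longrightarrow> q \<in> P \<Longrightarrow> p \<noteq> q \<Longrightarrow> r \<le> dist p q / 3" by blast
    define s where "s = Min (insert r ((\<lambda>p. dist a p / 3) ` P))"
    have fin: "finite (insert r ((\<lambda>p. dist a p / 3) ` P))" using insert.hyps by simp
    have "s > 0" unfolding s_def using insert.hyps r(1) by (subst Min_gr_iff) auto
    moreover have "s \<le> r" "\<And>p. p \<in> P \<Longrightarrow> s \<le> dist a p / 3"
      unfolding s_def by (rule Min_le[OF fin], simp)+
    ultimately show ?case using r(2)
      by (intro exI[of _ s]) (fastforce simp: dist_commute)
  qed (auto intro: exI[of _ 1])
  then obtain r where r: "r > 0" "\<And>p q. p \<in> P \<Longrightarrow> q \<in> P \<Longrightarrow> p \<noteq> q \<Longrightarrow> r \<le> dist p q / 3" by blast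
  have "cball p r \<inter> cball q r = {}" if "p \<in> P" "q \<in> P" "p \<noteq> q" for p q
  proof (rule ccontr)
    assume "cball p r \<inter> cball q r \<noteq> {}"
    then obtain x where "dist p x \<le> r" "dist q x \<le> r" by auto
    then have "dist p q \<le> 2 * r" using dist_triangle2[of p q x] by linarith
    moreover have "dist p q > 0" using that by simp
    ultimately show False using r(2)[OF that] by linarith
  qed
  then show ?thesis using r(1) by blast
qed

text \<open>
The coordinates are the distances to a sequence of points that is dense because it picks a point
from every basic open set.
\<close>
lemma compact_embeds_in_sequences:
  assumes "compact (UNIV :: 'a::metric_space set)"
  shows "\<exists>(e :: 'a \<Rightarrow> nat \<Rightarrow> real) g. homeomorphism UNIV (range e) e g"
proof -
  obtain B :: "nat \<Rightarrow> 'a set" where B: "\<forall>W. open W \<longrightarrow> (\<forall>x\<in>W. \<exists>n. x \<in> B n \<and> B n \<subseteq> W)"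
    using compact_countable_base[OF assms] by blast
  define d where "d n = (SOME x. x \<in> B n)" for n
  define e where "e x n = dist x (d n)" for x n
  have "continuous_on UNIV e"
    unfolding e_def by (intro continuous_intros)
  moreover have "inj e"
  proof (rule injI, rule ccontr)
    fix x y assume eq: "e x = e y" and "x \<noteq> y"
    define r where "r = dist x y / 2"
    have "x \<in> ball x r" using \<open>x \<noteq> y\<close> by (simp add: r_def)
    then obtain n where n: "x \<in> B n" "B n \<subseteq> ball x r" using B open_ball by blast
    then have "d n \<in> ball x r" unfolding d_def by (metis someI subsetD)
    then have "dist x (d n) < r" by simp
    moreover have "dist y (d n) = dist x (d n)" using fun_cong[OF eq, of n] by (simp add: e_def)
    ultimately show False using dist_triangle2[of x y "d n"] by (simp add: r_def)
  qed
  ultimately show ?thesis using homeomorphism_compact[OF assms] by blast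
qed

text \<open>
The embedded copy of \<open>X\<close> is compact, hence closed in the space of real sequences, which is one of
the ambient spaces that an ANR has to be a neighbourhood retract of.
\<close>
lemma ANR_space_neighbourhood_retraction:
  assumes "compact (UNIV :: 'a::metric_space set)" "ANR_space (euclidean :: 'a topology)"
  shows "\<exists>(e :: 'a \<Rightarrow> nat \<Rightarrow> real) U R. continuous_on UNIV e \<and> open U \<and> range e \<subseteq> U \<and>
           continuous_on U R \<and> (\<forall>x. R (e x) = x)"
proof -
  obtain e :: "'a \<Rightarrow> nat \<Rightarrow> real" and g where hom: "homeomorphism UNIV (range e) e g"
    using compact_embeds_in_sequences[OF assms(1)] by blast
  have e: "continuous_on UNIV e" and g: "continuous_on (range e) g" and ge: "\<And>x. g (e x) = x"
    using hom unfolding homeomorphism_def by auto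
  have "closed (range e)"
    using compact_continuous_image[OF e assms(1)] compact_imp_closed by blast
  moreover have "(euclidean :: 'a topology) homeomorphic_space top_of_set (range e)"
    unfolding homeomorphic_space_def homeomorphic_maps_def
    using e g ge by (intro exI[of _ e] exI[of _ g]) (auto simp: continuous_map_in_subtopology)
  ultimately have "\<exists>U. open U \<and> range e \<subseteq> U \<and> range e retract_of_space top_of_set U"
    using assms(2)[unfolded ANR_space_def, THEN conjunct2, rule_format, of euclidean "range e"]
    by (simp add: metrizable_space_euclidean)
  then obtain U where U: "open U" "range e \<subseteq> U" "range e retract_of_space top_of_set U"
    by blast
  obtain r where "continuous_map (top_of_set U) (subtopology (top_of_set U) (range e)) r"
      "\<forall>y\<in>range e. r y = y"
    using U(3) unfolding retract_of_space_def by blast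
  then have r: "continuous_on U r" "r ` U \<subseteq> range e" "\<And>x. r (e x) = e x"
    by (auto simp: continuous_map_in_subtopology Pi_iff)
  have "continuous_on U (g \<circ> r)"
    using continuous_on_compose[OF r(1) continuous_on_subset[OF g r(2)]] .
  moreover have "(g \<circ> r) (e x) = x" for x using r(3) ge by simp
  ultimately show ?thesis using e U(1,2) by blast
qed

text \<open>
\<open>H (y, z, t)\<close> is the point at time \<open>t\<close> on a path of size \<open>\<epsilon>\<close> from \<open>y\<close> to \<open>z\<close>.
\<close>
definition locally_equiconnected :: "'a::metric_space itself \<Rightarrow> bool" where
  "locally_equiconnected _ \<longleftrightarrow>
     (\<forall>\<epsilon>>0. \<exists>\<delta>>0. \<exists>H :: 'a \<times> 'a \<times> real \<Rightarrow> 'a.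
        continuous_on {(y, z, t). dist y z < \<delta> \<and> t \<in> {0..1}} H \<and>
        (\<forall>y z. dist y z < \<delta> \<longrightarrow>
           H (y, z, 0) = y \<and> H (y, z, 1) = z \<and> (\<forall>t\<in>{0..1}. dist (H (y, z, t)) y < \<epsilon>)))"

text \<open>
\<open>F\<close> is the straight segment in the sequence space and \<open>R\<close> retracts it back to \<open>X\<close>. For \<open>z = y\<close> the
segment is constant, so the set \<open>N\<close> of triples for which this is defined and stays \<open>\<epsilon>\<close>-close to \<open>y\<close>
is an open set around the compact set of all \<open>(y, y, t)\<close>; by compactness it contains a uniform
neighbourhood of it.
\<close>
lemma ANR_space_locally_equiconnected:
  assumes cpt: "compact (UNIV :: 'a::metric_space set)" and "ANR_space (euclidean :: 'a topology)"
  shows "locally_equiconnected TYPE('a)"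
  unfolding locally_equiconnected_def
proof (intro allI impI)
  fix \<epsilon> :: real assume "\<epsilon> > 0"
  obtain e :: "'a \<Rightarrow> nat \<Rightarrow> real" and U R where e: "continuous_on UNIV e"
    and U: "open U" "range e \<subseteq> U" and R: "continuous_on U R" "\<And>x. R (e x) = x"
    using ANR_space_neighbourhood_retraction[OF assms] by blast
  define F where "F p = (\<lambda>n. (1 - snd (snd p)) * e (fst p) n + snd (snd p) * e (fst (snd p)) n)"
    for p :: "'a \<times> 'a \<times> real"
  have en: "continuous_on UNIV (\<lambda>x. e x n)" for n
    using continuous_on_product_then_coordinatewise[OF e] .
  have F: "continuous_on UNIV F"
    unfolding F_def
    by (intro continuous_intros continuous_on_compose2[OF en]) auto
  have F0: "F (y, z, 0) = e y" and F1: "F (y, z, 1) = e z" and Fd: "F (y, y, t) = e y" for y z t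
    by (auto simp: F_def algebra_simps)
  have oU: "open (F -` U)" by (rule open_vimage[OF U(1) F])
  have RF: "continuous_on (F -` U) (\<lambda>p. R (F p))"
    by (rule continuous_on_compose2[OF R(1) continuous_on_subset[OF F]]) auto
  have "continuous_on (F -` U) (\<lambda>p. dist (R (F p)) (fst p))"
    by (intro continuous_intros RF)
  then have "open ((\<lambda>p. dist (R (F p)) (fst p)) -` {..<\<epsilon>} \<inter> (F -` U))"
    using continuous_on_open_vimage[OF oU] open_lessThan by blast
  moreover define N where "N = (\<lambda>p. dist (R (F p)) (fst p)) -` {..<\<epsilon>} \<inter> (F -` U)"
  ultimately have "open N" by simp
  define D where "D = (\<lambda>(y :: 'a, t :: real). (y, y, t)) ` (UNIV \<times> {0..1})"
  have "compact D"
    unfolding D_def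
    by (intro compact_continuous_image compact_Times cpt compact_Icc)
       (auto simp: case_prod_unfold intro!: continuous_intros)
  moreover have "D \<subseteq> N"
    using U(2) \<open>\<epsilon> > 0\<close> by (auto simp: D_def N_def Fd R(2))
  ultimately obtain \<delta> where \<delta>: "\<delta> > 0" "(\<Union>p\<in>D. ball p \<delta>) \<subseteq> N"
    using compact_subset_open_imp_ball_epsilon_subset \<open>open N\<close> by metis
  have sub: "{(y, z, t). dist y z < \<delta> \<and> t \<in> {0..1}} \<subseteq> N"
  proof safe
    fix y z :: 'a and t :: real assume "dist y z < \<delta>" "t \<in> {0..1}"
    then have "(y, y, t) \<in> D" "(y, z, t) \<in> ball (y, y, t) \<delta>"
      by (auto simp: D_def dist_Pair_Pair)
    then show "(y, z, t) \<in> N" using \<delta>(2) by blast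
  qed
  show "\<exists>\<delta>>0. \<exists>H :: 'a \<times> 'a \<times> real \<Rightarrow> 'a.
        continuous_on {(y, z, t). dist y z < \<delta> \<and> t \<in> {0..1}} H \<and>
        (\<forall>y z. dist y z < \<delta> \<longrightarrow>
           H (y, z, 0) = y \<and> H (y, z, 1) = z \<and> (\<forall>t\<in>{0..1}. dist (H (y, z, t)) y < \<epsilon>))"
  proof (intro exI[of _ \<delta>] exI[of _ "\<lambda>p. R (F p)"] conjI allI impI ballI \<open>\<delta> > 0\<close>)
    show "continuous_on {(y, z, t). dist y z < \<delta> \<and> t \<in> {0..1}} (\<lambda>p. R (F p))"
      using continuous_on_subset[OF RF] sub unfolding N_def by blast
  next
    fix y z :: 'a and t :: real assume "dist y z < \<delta>" "t \<in> {0..1}"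
    then have "(y, z, t) \<in> N" using sub by blast
    then show "dist (R (F (y, z, t))) y < \<epsilon>" by (simp add: N_def)
  qed (simp_all add: F0 F1 R(2))
qed

text \<open>
Around each \<open>p \<in> P\<close> the value \<open>f x\<close> is pushed towards \<open>q p\<close> along the path between them: entirely on
the ball of radius \<open>r / 2\<close>, not at all from distance \<open>r\<close> on. Since the balls are disjoint and every
point is moved along a single path, the number of points does not enter the estimate.
\<close>
lemma steerable_if_locally_equiconnected:
  assumes "locally_equiconnected TYPE('a::metric_space)"
  shows "steerable TYPE('a)"
  unfolding steerable_def
proof (intro allI impI)
  fix \<epsilon> :: real assume "\<epsilon> > 0"
  obtain \<delta> and H :: "'a \<times> 'a \<times> real \<Rightarrow> 'a" where "\<delta> > 0"
    and H: "continuous_on {(y, z, t). dist y z < \<delta> \<and> t \<in> {0..1}} H"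
    and Hyz: "\<forall>y z. dist y z < \<delta> \<longrightarrow>
           H (y, z, 0) = y \<and> H (y, z, 1) = z \<and> (\<forall>t\<in>{0..1}. dist (H (y, z, t)) y < \<epsilon>)"
    using mp[OF spec[OF assms[unfolded locally_equiconnected_def], of \<epsilon>] \<open>\<epsilon> > 0\<close>]
    by (elim exE conjE)
  show "\<exists>\<delta>>0. \<forall>(f :: 'a \<Rightarrow> 'a) P q.
        continuous_on UNIV f \<and> finite P \<and> (\<forall>p\<in>P. dist (f p) (q p) < \<delta>) \<longrightarrow>
        (\<exists>g. continuous_on UNIV g \<and> (\<forall>x. dist (g x) (f x) < \<epsilon>) \<and>
             (\<forall>p\<in>P. \<exists>W. open W \<and> p \<in> W \<and> (\<forall>x\<in>W. g x = q p)))"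
  proof (intro exI[of _ \<delta>] conjI allI impI \<open>\<delta> > 0\<close>, elim conjE)
    fix f q :: "'a \<Rightarrow> 'a" and P
    assume f: "continuous_on UNIV f" and P: "finite P" "\<forall>p\<in>P. dist (f p) (q p) < \<delta>"
    obtain r0 where r0: "r0 > 0" "\<And>p p'. p \<in> P \<Longrightarrow> p' \<in> P \<Longrightarrow> p \<noteq> p' \<Longrightarrow> cball p r0 \<inter> cball p' r0 = {}"
      using finite_disjoint_cballs[OF P(1)] by blast
    have "\<exists>s>0. \<forall>x\<in>cball p s. dist (f x) (q p) < \<delta>" if "p \<in> P" for p
    proof -
      have "open {x. dist (f x) (q p) < \<delta>}"
        by (intro open_Collect_less continuous_intros f)
      then show ?thesis using P(2) that unfolding open_contains_cball by blast
    qed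
    then obtain s where s: "\<And>p. p \<in> P \<Longrightarrow> s p > 0"
        "\<And>p x. p \<in> P \<Longrightarrow> x \<in> cball p (s p) \<Longrightarrow> dist (f x) (q p) < \<delta>" by metis
    define r where "r = Min (insert r0 (s ` P))"
    have "r > 0" using P(1) r0(1) s(1) by (simp add: r_def)
    have "r \<le> r0" "\<And>p. p \<in> P \<Longrightarrow> r \<le> s p" using P(1) by (auto simp: r_def)
    then have near: "\<And>p x. p \<in> P \<Longrightarrow> dist p x \<le> r \<Longrightarrow> dist (f x) (q p) < \<delta>"
      and uniq: "\<And>p p' x. p \<in> P \<Longrightarrow> p' \<in> P \<Longrightarrow> dist p x \<le> r \<Longrightarrow> dist p' x \<le> r \<Longrightarrow> p = p'"
      using s(2) r0(2) by (fastforce, meson disjoint_iff mem_cball order_trans)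
    \<comment> \<open>\<open>\<tau> p\<close> is the bump function at \<open>p\<close>, and \<open>c x\<close> is the centre of the ball that contains \<open>x\<close>.\<close>
    define \<tau> where "\<tau> p x = max 0 (min 1 (2 - 2 * dist p x / r))" for p x :: 'a
    define c where "c x = (THE p. p \<in> P \<and> dist p x \<le> r)" for x
    define g where "g x = (if \<exists>p\<in>P. dist p x \<le> r then H (f x, q (c x), \<tau> (c x) x) else f x)" for x
    have g_near: "g x = H (f x, q p, \<tau> p x)" if "p \<in> P" "dist p x \<le> r" for p x
    proof -
      have "c x = p" unfolding c_def using that uniq by (intro the_equality) auto
      then show ?thesis using that by (auto simp: g_def)
    qed
    have g_far: "g x = f x" if far: "\<forall>p\<in>P. dist p x \<ge> r" for x
    proof (cases "\<exists>p\<in>P. dist p x \<le> r")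
      case True
      then obtain p where p: "p \<in> P" "dist p x = r" using far by force
      then have "\<tau> p x = 0" using \<open>r > 0\<close> by (simp add: \<tau>_def)
      then show ?thesis using g_near[OF p(1)] near[OF p(1)] p(2) Hyz by simp
    qed (simp add: g_def)
    have \<tau>: "\<tau> p x \<in> {0..1}" for p x by (simp add: \<tau>_def)
    let ?far = "\<Inter>p\<in>P. {x. dist p x \<ge> r}"
    have "continuous_on ?far g"
      by (rule continuous_on_eq[OF continuous_on_subset[OF f]]) (auto simp: g_far)
    moreover have "continuous_on (\<Union>p\<in>P. cball p r) g"
    proof (rule continuous_on_closed_Union[OF P(1) closed_cball])
      fix p assume "p \<in> P"
      have "continuous_on (cball p r) (\<lambda>x. (f x, q p, \<tau> p x))"
        unfolding \<tau>_def using \<open>r > 0\<close>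
        by (intro continuous_intros continuous_on_subset[OF f]) auto
      then have "continuous_on (cball p r) (\<lambda>x. H (f x, q p, \<tau> p x))"
        by (rule continuous_on_compose2[OF H]) (use near[OF \<open>p \<in> P\<close>] \<tau> in auto)
      then show "continuous_on (cball p r) g"
        by (rule continuous_on_eq) (simp add: g_near[OF \<open>p \<in> P\<close>])
    qed
    moreover have "closed ?far"
      by (intro closed_INT ballI closed_Collect_le continuous_intros)
    moreover have "closed (\<Union>p\<in>P. cball p r)" using P(1) by (intro closed_UN) auto
    moreover have "?far \<union> (\<Union>p\<in>P. cball p r) = UNIV" by force
    ultimately have "continuous_on UNIV g" using continuous_on_closed_Un by metis
    moreover have "dist (g x) (f x) < \<epsilon>" for x
    proof (cases "\<exists>p\<in>P. dist p x \<le> r")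
      case True
      then obtain p where p: "p \<in> P" "dist p x \<le> r" by blast
      show ?thesis using g_near[OF p] Hyz near[OF p] \<tau> by simp
    next
      case False
      then have "g x = f x" by (simp add: g_def)
      then show ?thesis using \<open>\<epsilon> > 0\<close> by simp
    qed
    moreover have "\<exists>W. open W \<and> p \<in> W \<and> (\<forall>x\<in>W. g x = q p)" if "p \<in> P" for p
    proof (intro exI[of _ "ball p (r / 2)"] conjI ballI)
      fix x assume "x \<in> ball p (r / 2)"
      then have "dist p x \<le> r" "\<tau> p x = 1" using \<open>r > 0\<close> by (auto simp: \<tau>_def field_simps)
      then show "g x = q p" using g_near[OF that] near[OF that] Hyz by simp
    qed (use \<open>r > 0\<close> in auto)
    ultimately show "\<exists>g. continuous_on UNIV g \<and> (\<forall>x. dist (g x) (f x) < \<epsilon>) \<and>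
             (\<forall>p\<in>P. \<exists>W. open W \<and> p \<in> W \<and> (\<forall>x\<in>W. g x = q p))"
      by blast
  qed
qed

section \<open>Filling spheres and simplices\<close>

definition sphere_fills :: "nat \<Rightarrow> 'a::topological_space set \<Rightarrow> 'a set \<Rightarrow> bool" where
  "sphere_fills i V U \<longleftrightarrow>
     (\<forall>f. continuous_map (nsphere i) (top_of_set V) f \<longrightarrow>
        (\<exists>g. continuous_map (unit_ball_top (i + 1)) (top_of_set U) g \<and>
             (\<forall>y\<in>topspace (nsphere i). g y = f y)))"

lemma sphere_fills_mono:
  assumes fill: "sphere_fills i V U" and "V' \<subseteq> V" "U \<subseteq> U'"
  shows "sphere_fills i V' U'"
  unfolding sphere_fills_def
proof (intro allI impI)
  fix f assume "continuous_map (nsphere i) (top_of_set V') f"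
  then have "continuous_map (nsphere i) (top_of_set V) f"
    using \<open>V' \<subseteq> V\<close> by (auto simp: continuous_map_in_subtopology)
  then obtain g where "continuous_map (unit_ball_top (i + 1)) (top_of_set U) g"
      "\<forall>y\<in>topspace (nsphere i). g y = f y"
    using fill unfolding sphere_fills_def by blast
  moreover from this have "continuous_map (unit_ball_top (i + 1)) (top_of_set U') g"
    using \<open>U \<subseteq> U'\<close> by (auto simp: continuous_map_in_subtopology)
  ultimately show "\<exists>g. continuous_map (unit_ball_top (i + 1)) (top_of_set U') g \<and>
      (\<forall>y\<in>topspace (nsphere i). g y = f y)"
    by blast
qed

text \<open>
The neighbourhoods in the \<open>LC\<close> condition depend on the point; a Lebesgue number of the cover that
they form replaces them by balls of one radius.
\<close>
lemma LC_space_uniform: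
  assumes cpt: "compact (UNIV :: 'a::metric_space set)" and LC: "LC_space m (euclidean :: 'a topology)"
    and "\<epsilon> > 0"
  shows "\<exists>\<delta>>0. \<forall>(y :: 'a) i. int i \<le> m \<longrightarrow> sphere_fills i (ball y \<delta>) (ball y \<epsilon>)"
proof -
  have "\<exists>V. open V \<and> x \<in> V \<and> V \<subseteq> ball x (\<epsilon> / 2) \<and>
      (\<forall>i. int i \<le> m \<longrightarrow> sphere_fills i V (ball x (\<epsilon> / 2)))" for x :: 'a
  proof -
    have "openin euclidean (ball x (\<epsilon> / 2)) \<and> x \<in> ball x (\<epsilon> / 2)" using \<open>\<epsilon> > 0\<close> by simp
    from LC[unfolded LC_space_def, rule_format, OF this]
    show ?thesis unfolding sphere_fills_def by (simp add: Ball_def) blast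
  qed
  then obtain V where V: "\<And>x. open (V x)" "\<And>x. x \<in> V x" "\<And>x :: 'a. V x \<subseteq> ball x (\<epsilon> / 2)"
      "\<And>x i. int i \<le> m \<Longrightarrow> sphere_fills i (V x) (ball x (\<epsilon> / 2))"
    by metis
  have "UNIV \<subseteq> \<Union>(range V)" using V(2) by blast
  then obtain \<delta> where "\<delta> > 0" and \<delta>: "\<And>y. y \<in> UNIV \<Longrightarrow> \<exists>W\<in>range V. ball y \<delta> \<subseteq> W"
    by (rule Heine_Borel_lemma[OF cpt]) (use V(1) in auto)
  have "sphere_fills i (ball y \<delta>) (ball y \<epsilon>)" if "int i \<le> m" for y :: 'a and i
  proof -
    obtain x where x: "ball y \<delta> \<subseteq> V x" using \<delta> by blast
    have "y \<in> ball y \<delta>" using \<open>\<delta> > 0\<close> by simp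
    then have "y \<in> ball x (\<epsilon> / 2)" using x V(3)[of x] by blast
    have "ball x (\<epsilon> / 2) \<subseteq> ball y \<epsilon>"
    proof
      fix z assume "z \<in> ball x (\<epsilon> / 2)"
      then show "z \<in> ball y \<epsilon>"
        using \<open>y \<in> ball x (\<epsilon> / 2)\<close> dist_triangle3[of y z x] by simp
    qed
    then show ?thesis using sphere_fills_mono[OF V(4)[OF that] x] by blast
  qed
  then show ?thesis using \<open>\<delta> > 0\<close> by blast
qed

lemma continuous_on_Min_finite:
  fixes F :: "'i \<Rightarrow> 'b::topological_space \<Rightarrow> real"
  assumes "finite A" "A \<noteq> {}" "\<And>j. j \<in> A \<Longrightarrow> continuous_on S (F j)"
  shows "continuous_on S (\<lambda>x. Min ((\<lambda>j. F j x) ` A))"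
  using assms
  by (induction A rule: finite_ne_induct) (auto intro!: continuous_intros)

text \<open>
The geometric simplex with vertex set \<open>\<sigma>\<close> in barycentric coordinates. All simplices with vertices
in one type live in the same function space, so that they can be glued along their faces.
\<close>
definition simplex_on :: "'v set \<Rightarrow> ('v \<Rightarrow> real) set" where
  "simplex_on \<sigma> = {t. (\<forall>v. 0 \<le> t v) \<and> (\<forall>v. v \<notin> \<sigma> \<longrightarrow> t v = 0) \<and> sum t \<sigma> = 1}"

definition simplex_boundary :: "'v set \<Rightarrow> ('v \<Rightarrow> real) set" where
  "simplex_boundary \<sigma> = {t \<in> simplex_on \<sigma>. \<exists>v\<in>\<sigma>. t v = 0}"

lemma continuous_on_coordinate: "continuous_on S (\<lambda>t. t v :: real)"
  by (rule continuous_on_subset[OF continuous_on_product_coordinates]) simp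

lemma closed_simplex_on: "closed (simplex_on \<sigma>)"
proof -
  have "simplex_on \<sigma> = (\<Inter>v. {t. 0 \<le> t v}) \<inter> (\<Inter>v\<in>- \<sigma>. {t. t v = 0}) \<inter> {t. sum t \<sigma> = 1}"
    unfolding simplex_on_def by auto
  also have "closed \<dots>"
    by (intro closed_Int closed_INT ballI closed_Collect_le closed_Collect_eq
        continuous_on_sum continuous_on_const continuous_on_coordinate)
  finally show ?thesis .
qed

lemma nsphere_top_of_set:
  "nsphere i = top_of_set {x. (\<Sum>j\<le>i. (x j)\<^sup>2) = 1 \<and> (\<forall>j>i. x j = 0)}"
  by (simp add: nsphere euclidean_product_topology)

lemma unit_ball_top_top_of_set:
  "unit_ball_top (i + 1) = top_of_set {x. (\<Sum>j\<le>i. (x j)\<^sup>2) \<le> 1 \<and> (\<forall>j>i. x j = 0)}"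
proof -
  have "{x. \<forall>j\<ge>i + 1. x j = (0::real)} \<inter> {x. (\<Sum>k<i + 1. (x k)\<^sup>2) \<le> 1} =
      {x. (\<Sum>j\<le>i. (x j)\<^sup>2) \<le> 1 \<and> (\<forall>j>i. x j = 0)}"
    by (auto simp: lessThan_Suc_atMost Suc_le_eq)
  then show ?thesis
    unfolding unit_ball_top_def Euclidean_space_def subtopology_subtopology euclidean_product_topology
    by simp
qed

text \<open>
The pair consisting of the simplex and its boundary is compared with the pair consisting of the ball
and the sphere. It suffices to have continuous maps \<open>h\<close> from the first pair to the second and \<open>k\<close>
from the sphere to the boundary with \<open>k \<circ> h\<close> the identity on the boundary: if \<open>G\<close> extends \<open>f \<circ> k\<close>
over the ball, then \<open>G \<circ> h\<close> extends \<open>f\<close> over the simplex.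
\<close>
lemma sphere_fills_simplex:
  fixes f :: "('v \<Rightarrow> real) \<Rightarrow> 'a::metric_space"
  assumes card: "card \<sigma> = i + 2" and fill: "sphere_fills i V U"
    and f: "continuous_on (simplex_boundary \<sigma>) f" "f ` simplex_boundary \<sigma> \<subseteq> V"
  shows "\<exists>g. continuous_on (simplex_on \<sigma>) g \<and> g ` simplex_on \<sigma> \<subseteq> U \<and>
           (\<forall>t\<in>simplex_boundary \<sigma>. g t = f t)"
proof -
  let ?S = "{x :: nat \<Rightarrow> real. (\<Sum>j\<le>i. (x j)\<^sup>2) = 1 \<and> (\<forall>j>i. x j = 0)}"
  let ?B = "{x :: nat \<Rightarrow> real. (\<Sum>j\<le>i. (x j)\<^sup>2) \<le> 1 \<and> (\<forall>j>i. x j = 0)}"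
  have fin: "finite \<sigma>" using card by (intro card_ge_0_finite) simp
  have "{0..<card \<sigma>} = {..Suc i}" using card by auto
  then obtain s where s: "bij_betw s {..Suc i} \<sigma>" using ex_bij_betw_nat_finite[OF fin] by metis
  define idx where "idx = the_inv_into {..Suc i} s"
  have idx: "idx (s j) = j" if "j \<le> Suc i" for j
    using s that unfolding idx_def bij_betw_def by (simp add: the_inv_into_f_f)
  have s_in: "s j \<in> \<sigma>" if "j \<le> Suc i" for j using s that unfolding bij_betw_def by blast
  have s_onto: "\<exists>j\<le>Suc i. v = s j" if "v \<in> \<sigma>" for v using s that unfolding bij_betw_def by blast
  have sum_s: "sum G \<sigma> = (\<Sum>j\<le>Suc i. G (s j))" for G :: "'v \<Rightarrow> real"
    using sum.reindex_bij_betw[OF s, of G] by simp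

  \<comment> \<open>The coordinates \<open>u t\<close> vanish exactly at the barycentre, and \<open>h t\<close> is \<open>u t\<close> divided by its norm on
    the boundary. The product of the barycentric coordinates, which is zero exactly on the boundary,
    keeps the denominator positive at the barycentre.\<close>
  define u where "u t j = t (s j) - t (s (Suc i))" for t :: "'v \<Rightarrow> real" and j
  define c where "c t = sqrt (\<Sum>j\<le>i. (u t j)\<^sup>2) + (\<Prod>v\<in>\<sigma>. t v)" for t
  define h where "h t j = (if j \<le> i then u t j / c t else 0)" for t j
  have c_pos: "c t > 0" if t: "t \<in> simplex_on \<sigma>" for t
  proof (rule ccontr)
    assume "\<not> c t > 0"
    moreover have "(\<Sum>j\<le>i. (u t j)\<^sup>2) \<ge> 0" by (intro sum_nonneg) simp
    moreover have "(\<Prod>v\<in>\<sigma>. t v) \<ge> 0" using t by (intro prod_nonneg) (simp add: simplex_on_def)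
    ultimately have 0: "(\<Sum>j\<le>i. (u t j)\<^sup>2) = 0" "(\<Prod>v\<in>\<sigma>. t v) = 0"
      unfolding c_def by (smt (verit) real_sqrt_ge_zero real_sqrt_eq_zero_cancel_iff)+
    have "t (s j) = t (s (Suc i))" if "j \<le> Suc i" for j
    proof (cases "j = Suc i")
      case False
      then have "(u t j)\<^sup>2 = 0"
        using 0(1) that sum_nonneg_eq_0_iff[of "{..i}" "\<lambda>j. (u t j)\<^sup>2"] by simp
      then show ?thesis by (simp add: u_def)
    qed simp
    moreover obtain j where "j \<le> Suc i" "t (s j) = 0"
      using 0(2) fin s_onto by (auto simp: prod_zero_iff)
    ultimately have "t (s j) = 0" if "j \<le> Suc i" for j using that by metis
    then have "sum t \<sigma> = 0" by (simp add: sum_s)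
    then show False using t by (simp add: simplex_on_def)
  qed
  have norm_h: "(\<Sum>j\<le>i. (h t j)\<^sup>2) = (\<Sum>j\<le>i. (u t j)\<^sup>2) / (c t)\<^sup>2" for t
    by (simp add: h_def power_divide sum_divide_distrib)
  have h_cont: "continuous_on (simplex_on \<sigma>) h"
  proof (rule continuous_on_coordinatewise_then_product)
    fix j
    have "continuous_on (simplex_on \<sigma>) (\<lambda>t. u t j / c t)"
      unfolding u_def c_def
      by (intro continuous_intros continuous_on_coordinate ballI)
        (use c_pos in \<open>force simp: c_def u_def\<close>)
    then show "continuous_on (simplex_on \<sigma>) (\<lambda>t. h t j)"
      by (cases "j \<le> i") (simp_all add: h_def)
  qed
  have h_ball: "h t \<in> ?B" if t: "t \<in> simplex_on \<sigma>" for t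
  proof -
    let ?q = "\<Sum>j\<le>i. (u t j)\<^sup>2"
    have "?q \<ge> 0" by (intro sum_nonneg) simp
    moreover have "(\<Prod>v\<in>\<sigma>. t v) \<ge> 0" using t by (intro prod_nonneg) (simp add: simplex_on_def)
    ultimately have "sqrt ?q \<le> c t" "sqrt ?q \<ge> 0" by (simp_all add: c_def)
    then have "(sqrt ?q)\<^sup>2 \<le> (c t)\<^sup>2" by (intro power_mono)
    then have "?q \<le> (c t)\<^sup>2" using \<open>?q \<ge> 0\<close> by simp
    then have "?q / (c t)\<^sup>2 \<le> 1" using c_pos[OF t] by simp
    then have "(\<Sum>j\<le>i. (h t j)\<^sup>2) \<le> 1" unfolding norm_h .
    moreover have "\<forall>j>i. h t j = 0" by (simp add: h_def)
    ultimately show ?thesis by blast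
  qed
  have h_sphere: "h t \<in> ?S" if t: "t \<in> simplex_boundary \<sigma>" for t
  proof -
    let ?q = "\<Sum>j\<le>i. (u t j)\<^sup>2"
    have "(\<Prod>v\<in>\<sigma>. t v) = 0" using t fin by (auto simp: simplex_boundary_def)
    then have "c t = sqrt ?q" by (simp add: c_def)
    moreover have "c t > 0" using t c_pos by (simp add: simplex_boundary_def)
    ultimately have "(c t)\<^sup>2 = ?q" "(c t)\<^sup>2 \<noteq> 0" by (simp_all add: sum_nonneg)
    then have "?q / (c t)\<^sup>2 = 1" by (metis divide_self)
    then have "(\<Sum>j\<le>i. (h t j)\<^sup>2) = 1" unfolding norm_h .
    moreover have "\<forall>j>i. h t j = 0" by (simp add: h_def)
    ultimately show ?thesis by blast
  qed

  \<comment> \<open>The point \<open>h t\<close> determines the differences of the coordinates of \<open>t\<close> up to a common positive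
    factor. A boundary point has least coordinate \<open>0\<close> and coordinate sum \<open>1\<close>, so it is recovered by
    subtracting the minimum and dividing by the sum. The last vertex gets the coordinate
    \<open>w (Suc i) = 0\<close>.\<close>
  define mn where "mn w = Min (w ` {..Suc i})" for w :: "nat \<Rightarrow> real"
  define D where "D w = (\<Sum>j\<le>Suc i. w j - mn w)" for w :: "nat \<Rightarrow> real"
  define k where "k w v = (if v \<in> \<sigma> then (w (idx v) - mn w) / D w else 0)" for w v
  have mn_le: "mn w \<le> w j" if "j \<le> Suc i" for w j
    unfolding mn_def using that by (intro Min_le) auto
  have mn_in: "\<exists>j\<le>Suc i. w j = mn w" for w
  proof -
    have "mn w \<in> w ` {..Suc i}" unfolding mn_def by (intro Min_in) auto
    then show ?thesis by auto
  qed
  have D_pos: "D w > 0" if w: "w \<in> ?S" for w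
  proof (rule ccontr)
    assume "\<not> D w > 0"
    moreover have "D w \<ge> 0" unfolding D_def using mn_le by (intro sum_nonneg) simp
    ultimately have "D w = 0" by simp
    then have eq: "w j = mn w" if "j \<le> Suc i" for j
      using that mn_le sum_nonneg_eq_0_iff[of "{..Suc i}" "\<lambda>j. w j - mn w"]
      unfolding D_def by simp
    have "w (Suc i) = 0" using w by simp
    then have "w j = 0" if "j \<le> i" for j using eq[of j] eq[of "Suc i"] that by simp
    then have "(\<Sum>j\<le>i. (w j)\<^sup>2) = 0" by simp
    then show False using w by simp
  qed
  have k_boundary: "k w \<in> simplex_boundary \<sigma>" if w: "w \<in> ?S" for w
  proof -
    have "k w v \<ge> 0" for v
    proof (cases "v \<in> \<sigma>")
      case True
      then obtain j where "j \<le> Suc i" "v = s j" using s_onto by blast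
      then show ?thesis using mn_le[of j w] D_pos[OF w] True by (simp add: k_def idx)
    qed (simp add: k_def)
    moreover have "sum (k w) \<sigma> = 1"
    proof -
      have "sum (k w) \<sigma> = (\<Sum>j\<le>Suc i. (w j - mn w) / D w)"
        unfolding sum_s by (intro sum.cong) (simp_all add: k_def idx s_in)
      also have "\<dots> = D w / D w" unfolding D_def sum_divide_distrib ..
      finally show ?thesis using D_pos[OF w] by simp
    qed
    moreover obtain j where "j \<le> Suc i" "w j = mn w" using mn_in by blast
    then have "s j \<in> \<sigma>" "k w (s j) = 0" by (simp_all add: k_def idx s_in)
    ultimately show ?thesis
      unfolding simplex_boundary_def simplex_on_def by (auto simp: k_def)
  qed
  have mn_cont: "continuous_on ?S mn"
    unfolding mn_def by (rule continuous_on_Min_finite) (auto intro: continuous_on_coordinate)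
  have k_cont: "continuous_on ?S k"
  proof (rule continuous_on_coordinatewise_then_product)
    fix v
    have "D w \<noteq> 0" if "w \<in> ?S" for w using D_pos[OF that] by simp
    moreover have "continuous_on ?S D" unfolding D_def by (intro continuous_intros continuous_on_coordinate mn_cont)
    ultimately have "continuous_on ?S (\<lambda>w. (w (idx v) - mn w) / D w)"
      by (intro continuous_intros continuous_on_coordinate mn_cont) auto
    then show "continuous_on ?S (\<lambda>w. k w v)"
      by (cases "v \<in> \<sigma>") (simp_all add: k_def)
  qed
  have kh: "k (h t) = t" if t: "t \<in> simplex_boundary \<sigma>" for t
  proof -
    have tS: "t \<in> simplex_on \<sigma>" using t by (simp add: simplex_boundary_def)
    have c0: "c t > 0" by (rule c_pos[OF tS])
    have h_eq: "h t j = (t (s j) - t (s (Suc i))) / c t" if "j \<le> Suc i" for j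
      using that by (cases "j = Suc i") (simp_all add: h_def u_def)
    obtain j0 where j0: "j0 \<le> Suc i" "t (s j0) = 0"
      using t s_onto by (auto simp: simplex_boundary_def)
    have "mn (h t) = - t (s (Suc i)) / c t"
    proof (rule antisym)
      show "mn (h t) \<le> - t (s (Suc i)) / c t" using mn_le[OF j0(1), of "h t"] j0 by (simp add: h_eq)
      obtain j where j: "j \<le> Suc i" "h t j = mn (h t)" using mn_in by blast
      have "t (s j) \<ge> 0" using tS by (simp add: simplex_on_def)
      then have "- t (s (Suc i)) / c t \<le> h t j"
        unfolding h_eq[OF j(1)] using c0 by (intro divide_right_mono) auto
      then show "- t (s (Suc i)) / c t \<le> mn (h t)" using j(2) by simp
    qed
    then have diff: "h t j - mn (h t) = t (s j) / c t" if "j \<le> Suc i" for j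
      unfolding h_eq[OF that] by (simp add: diff_divide_distrib)
    have "D (h t) = (\<Sum>j\<le>Suc i. t (s j) / c t)"
      unfolding D_def by (intro sum.cong refl diff) simp
    also have "\<dots> = sum t \<sigma> / c t" unfolding sum_s sum_divide_distrib ..
    finally have D: "D (h t) = 1 / c t" using tS by (simp add: simplex_on_def)
    show ?thesis
    proof
      fix v
      show "k (h t) v = t v"
      proof (cases "v \<in> \<sigma>")
        case True
        then obtain j where "j \<le> Suc i" "v = s j" using s_onto by blast
        then show ?thesis using True c0 by (simp add: k_def idx diff D)
      next
        case False
        then show ?thesis using tS by (simp add: k_def simplex_on_def)
      qed
    qed
  qed

  have "continuous_on ?S (f \<circ> k)"
    by (rule continuous_on_compose[OF k_cont continuous_on_subset[OF f(1)]]) (use k_boundary in blast)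
  moreover have "(f \<circ> k) ` ?S \<subseteq> V" using f(2) k_boundary by auto
  ultimately have "continuous_map (nsphere i) (top_of_set V) (f \<circ> k)"
    unfolding nsphere_top_of_set continuous_map_in_subtopology by auto
  then obtain G where G: "continuous_map (unit_ball_top (i + 1)) (top_of_set U) G"
      "\<forall>y\<in>topspace (nsphere i). G y = (f \<circ> k) y"
    using fill unfolding sphere_fills_def by blast
  have GB: "continuous_on ?B G" "G ` ?B \<subseteq> U"
    using G(1) unfolding unit_ball_top_top_of_set continuous_map_in_subtopology by auto
  have "continuous_on (simplex_on \<sigma>) (G \<circ> h)"
    by (rule continuous_on_compose[OF h_cont continuous_on_subset[OF GB(1)]]) (use h_ball in blast)
  moreover have "(G \<circ> h) ` simplex_on \<sigma> \<subseteq> U" using h_ball GB(2) unfolding image_comp[symmetric] by blast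
  moreover have "(G \<circ> h) t = f t" if "t \<in> simplex_boundary \<sigma>" for t
  proof -
    have "h t \<in> topspace (nsphere i)" using h_sphere[OF that] by (simp add: nsphere_top_of_set)
    then show ?thesis using G(2) kh[OF that] by simp
  qed
  ultimately show ?thesis by blast
qed

section \<open>Maps on skeleta of finite complexes\<close>

definition vertex :: "'v \<Rightarrow> 'v \<Rightarrow> real" where
  "vertex v = (\<lambda>w. if w = v then 1 else 0)"

definition complex_of_simplices :: "'v set set \<Rightarrow> bool" where
  "complex_of_simplices \<K> \<longleftrightarrow>
     finite \<K> \<and> (\<forall>\<sigma>\<in>\<K>. finite \<sigma> \<and> \<sigma> \<noteq> {} \<and> (\<forall>\<tau>. \<tau> \<subseteq> \<sigma> \<and> \<tau> \<noteq> {} \<longrightarrow> \<tau> \<in> \<K>))"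

definition skeleton :: "'v set set \<Rightarrow> nat \<Rightarrow> ('v \<Rightarrow> real) set" where
  "skeleton \<K> m = (\<Union>\<sigma>\<in>{\<sigma>\<in>\<K>. card \<sigma> \<le> m + 1}. simplex_on \<sigma>)"

lemma simplex_on_singleton: "simplex_on {v} = {vertex v}"
  by (auto simp: simplex_on_def vertex_def fun_eq_iff)

lemma simplex_on_support:
  assumes t: "t \<in> simplex_on \<sigma>" and "finite \<sigma>"
  shows "{v. t v \<noteq> 0} \<subseteq> \<sigma>" "{v. t v \<noteq> 0} \<noteq> {}" "t \<in> simplex_on {v. t v \<noteq> 0}"
proof -
  show sub: "{v. t v \<noteq> 0} \<subseteq> \<sigma>" using t by (auto simp: simplex_on_def)
  have "sum t {v. t v \<noteq> 0} = sum t \<sigma>" using sub \<open>finite \<sigma>\<close> by (intro sum.mono_neutral_left) auto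
  then have 1: "sum t {v. t v \<noteq> 0} = 1" using t by (simp add: simplex_on_def)
  show "{v. t v \<noteq> 0} \<noteq> {}"
  proof
    assume "{v. t v \<noteq> 0} = {}"
    then show False using 1 by (metis sum.empty zero_neq_one)
  qed
  show "t \<in> simplex_on {v. t v \<noteq> 0}" using 1 t by (simp add: simplex_on_def)
qed

lemma simplex_boundary_iff:
  assumes "t \<in> simplex_on \<sigma>" "finite \<sigma>"
  shows "t \<in> simplex_boundary \<sigma> \<longleftrightarrow> card {v. t v \<noteq> 0} < card \<sigma>"
proof -
  have "t \<in> simplex_boundary \<sigma> \<longleftrightarrow> {v. t v \<noteq> 0} \<subset> \<sigma>"
    using simplex_on_support(1)[OF assms] assms(1) by (auto simp: simplex_boundary_def)
  also have "\<dots> \<longleftrightarrow> card {v. t v \<noteq> 0} < card \<sigma>"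
    using simplex_on_support(1)[OF assms] assms(2) by (metis nless_le psubset_card_mono psubset_eq)
  finally show ?thesis .
qed

lemma mem_skeleton_iff:
  assumes "complex_of_simplices \<K>" "\<sigma> \<in> \<K>" "t \<in> simplex_on \<sigma>"
  shows "t \<in> skeleton \<K> m \<longleftrightarrow> card {v. t v \<noteq> 0} \<le> m + 1"
proof
  assume "t \<in> skeleton \<K> m"
  then obtain \<tau> where \<tau>: "\<tau> \<in> \<K>" "card \<tau> \<le> m + 1" "t \<in> simplex_on \<tau>" unfolding skeleton_def by blast
  then have "finite \<tau>" using assms(1) unfolding complex_of_simplices_def by blast
  then have "card {v. t v \<noteq> 0} \<le> card \<tau>" using simplex_on_support(1)[OF \<tau>(3)] by (intro card_mono)
  then show "card {v. t v \<noteq> 0} \<le> m + 1" using \<tau>(2) by simp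
next
  assume card: "card {v. t v \<noteq> 0} \<le> m + 1"
  have "finite \<sigma>" using assms(1,2) unfolding complex_of_simplices_def by blast
  note supp = simplex_on_support[OF assms(3) this]
  then have "{v. t v \<noteq> 0} \<in> \<K>" using assms(1,2) unfolding complex_of_simplices_def by blast
  then show "t \<in> skeleton \<K> m" using supp(3) card unfolding skeleton_def by blast
qed

text \<open>
A point of the next skeleton outside the \<open>m\<close>-skeleton lies in the interior of exactly one \<open>(m + 1)\<close>-simplex, whose vertex
set is the support of the point. This decides which of the extensions to use, and the pieces fit
together continuously because the complex is a finite union of closed simplices.
\<close>
lemma extension_over_next_skeleton:
  fixes r :: "('v \<Rightarrow> real) \<Rightarrow> 'a::metric_space"
  assumes \<K>: "complex_of_simplices \<K>" and r: "continuous_on (skeleton \<K> m) r"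
    and ext: "\<And>\<sigma>. \<sigma> \<in> \<K> \<Longrightarrow> card \<sigma> = m + 2 \<Longrightarrow>
      \<exists>g. continuous_on (simplex_on \<sigma>) g \<and> g ` simplex_on \<sigma> \<subseteq> U \<sigma> \<and> (\<forall>t\<in>simplex_boundary \<sigma>. g t = r t)"
  shows "\<exists>r'. continuous_on (skeleton \<K> (Suc m)) r' \<and> (\<forall>t\<in>skeleton \<K> m. r' t = r t) \<and>
           (\<forall>\<sigma>\<in>\<K>. card \<sigma> = m + 2 \<longrightarrow> r' ` simplex_on \<sigma> \<subseteq> U \<sigma>)"
proof -
  have "\<exists>g. \<forall>\<sigma>. \<sigma> \<in> \<K> \<and> card \<sigma> = m + 2 \<longrightarrow> continuous_on (simplex_on \<sigma>) (g \<sigma>) \<and>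
      g \<sigma> ` simplex_on \<sigma> \<subseteq> U \<sigma> \<and> (\<forall>t\<in>simplex_boundary \<sigma>. g \<sigma> t = r t)"
    using ext by (intro choice) blast
  then obtain g where "\<forall>\<sigma>. \<sigma> \<in> \<K> \<and> card \<sigma> = m + 2 \<longrightarrow> continuous_on (simplex_on \<sigma>) (g \<sigma>) \<and>
      g \<sigma> ` simplex_on \<sigma> \<subseteq> U \<sigma> \<and> (\<forall>t\<in>simplex_boundary \<sigma>. g \<sigma> t = r t)" ..
  then have g: "continuous_on (simplex_on \<sigma>) (g \<sigma>)" "g \<sigma> ` simplex_on \<sigma> \<subseteq> U \<sigma>"
      "\<And>t. t \<in> simplex_boundary \<sigma> \<Longrightarrow> g \<sigma> t = r t" if "\<sigma> \<in> \<K>" "card \<sigma> = m + 2" for \<sigma>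
    using that by simp_all
  define r' where "r' t = (if t \<in> skeleton \<K> m then r t else g {v. t v \<noteq> 0} t)" for t
  have fin: "finite \<sigma>" if "\<sigma> \<in> \<K>" for \<sigma>
    using \<K> that unfolding complex_of_simplices_def by blast
  have r'_g: "r' t = g \<sigma> t" if \<sigma>: "\<sigma> \<in> \<K>" "card \<sigma> = m + 2" and t: "t \<in> simplex_on \<sigma>" for \<sigma> t
  proof (cases "t \<in> skeleton \<K> m")
    case True
    then have "card {v. t v \<noteq> 0} < card \<sigma>" using mem_skeleton_iff[OF \<K> \<sigma>(1) t] \<sigma>(2) by simp
    then have "t \<in> simplex_boundary \<sigma>" using simplex_boundary_iff[OF t fin[OF \<sigma>(1)]] by simp
    then show ?thesis using True g(3)[OF \<sigma>] by (simp add: r'_def)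
  next
    case False
    then have "card \<sigma> \<le> card {v. t v \<noteq> 0}" using mem_skeleton_iff[OF \<K> \<sigma>(1) t] \<sigma>(2) by simp
    then have "{v. t v \<noteq> 0} = \<sigma>"
      using card_seteq[OF fin[OF \<sigma>(1)] simplex_on_support(1)[OF t fin[OF \<sigma>(1)]]] by blast
    then show ?thesis using False by (simp add: r'_def)
  qed
  have split: "skeleton \<K> (Suc m) = skeleton \<K> m \<union> (\<Union>\<sigma>\<in>{\<sigma>\<in>\<K>. card \<sigma> = m + 2}. simplex_on \<sigma>)"
    unfolding skeleton_def by (auto simp: le_Suc_eq)
  have finK: "finite {\<sigma>\<in>\<K>. Q \<sigma>}" for Q
    using \<K> unfolding complex_of_simplices_def by simp
  have closed_Un: "closed (\<Union>\<sigma>\<in>{\<sigma>\<in>\<K>. Q \<sigma>}. simplex_on \<sigma>)" for Q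
    by (intro closed_UN finK ballI closed_simplex_on)
  have "continuous_on (skeleton \<K> m) r'"
    by (rule continuous_on_eq[OF r]) (simp add: r'_def)
  moreover have "continuous_on (\<Union>\<sigma>\<in>{\<sigma>\<in>\<K>. card \<sigma> = m + 2}. simplex_on \<sigma>) r'"
  proof (rule continuous_on_closed_Union[OF finK closed_simplex_on])
    fix \<sigma> assume "\<sigma> \<in> {\<sigma>\<in>\<K>. card \<sigma> = m + 2}"
    then show "continuous_on (simplex_on \<sigma>) r'"
      using continuous_on_eq[OF g(1)] r'_g by (metis (mono_tags, lifting) mem_Collect_eq)
  qed
  moreover have "closed (skeleton \<K> m)" unfolding skeleton_def by (rule closed_Un)
  ultimately have "continuous_on (skeleton \<K> (Suc m)) r'"
    unfolding split by (intro continuous_on_closed_Un closed_Un)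
  moreover have "r' ` simplex_on \<sigma> \<subseteq> U \<sigma>" if "\<sigma> \<in> \<K>" "card \<sigma> = m + 2" for \<sigma>
    using g(2)[OF that] r'_g[OF that] by auto
  ultimately show ?thesis by (intro exI[of _ r']) (simp add: r'_def)
qed

text \<open>
The map on the vertices is extended over one skeleton after the other. In the step from \<open>m\<close> to
\<open>m + 1\<close> the image of the boundary of a simplex lies in a ball of radius \<open>\<delta>\<close> around the image of one
chosen vertex \<open>a \<sigma>\<close>, in which spheres of dimension \<open>m\<close> can be filled. The constants are determined
downwards from the top dimension.
\<close>
lemma skeleton_realization:
  assumes fills: "\<forall>i<m. \<forall>\<epsilon>>0. \<exists>\<delta>>0. \<forall>y :: 'a::metric_space. sphere_fills i (ball y \<delta>) (ball y \<epsilon>)"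
    and "\<epsilon> > 0"
  shows "\<exists>\<eta>>0. \<forall>\<K> (r0 :: 'v \<Rightarrow> 'a).
      complex_of_simplices \<K> \<and> (\<forall>\<sigma>\<in>\<K>. \<forall>v\<in>\<sigma>. \<forall>w\<in>\<sigma>. dist (r0 v) (r0 w) < \<eta>) \<longrightarrow>
      (\<exists>r. continuous_on (skeleton \<K> m) r \<and> (\<forall>v. {v} \<in> \<K> \<longrightarrow> r (vertex v) = r0 v) \<and>
           (\<forall>\<sigma>\<in>\<K>. card \<sigma> \<le> m + 1 \<longrightarrow> (\<forall>t\<in>simplex_on \<sigma>. \<forall>v\<in>\<sigma>. dist (r t) (r0 v) < \<epsilon>)))"
  using assms
proof (induction m arbitrary: \<epsilon>)
  case 0
  show ?case
  proof (intro exI[of _ 1] conjI allI impI, simp, elim conjE)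
    fix \<K> :: "'v set set" and r0 :: "'v \<Rightarrow> 'a"
    assume \<K>: "complex_of_simplices \<K>"
    define r where "r t = r0 (THE v. t = vertex v)" for t
    have vertex_eq: "vertex v = vertex w \<longleftrightarrow> v = w" for v w :: 'v
      by (metis vertex_def zero_neq_one)
    have r: "r (vertex v) = r0 v" for v by (simp add: r_def vertex_eq)
    have singleton: "\<exists>v. \<sigma> = {v}" if "\<sigma> \<in> \<K>" "card \<sigma> \<le> 0 + 1" for \<sigma>
    proof -
      have "finite \<sigma>" "\<sigma> \<noteq> {}" using \<K> that(1) unfolding complex_of_simplices_def by blast+
      then have "card \<sigma> = 1" using that(2) card_gt_0_iff[of \<sigma>] by linarith
      then show ?thesis by (rule card_1_singletonE) blast
    qed
    have "continuous_on (skeleton \<K> 0) r"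
      unfolding skeleton_def
    proof (rule continuous_on_closed_Union[OF _ closed_simplex_on])
      show "finite {\<sigma> \<in> \<K>. card \<sigma> \<le> 0 + 1}" using \<K> unfolding complex_of_simplices_def by simp
      fix \<sigma> assume "\<sigma> \<in> {\<sigma> \<in> \<K>. card \<sigma> \<le> 0 + 1}"
      then obtain v where "\<sigma> = {v}" using singleton by blast
      then show "continuous_on (simplex_on \<sigma>) r" by (simp add: simplex_on_singleton)
    qed
    moreover have "dist (r t) (r0 v) < \<epsilon>"
      if \<sigma>: "\<sigma> \<in> \<K>" "card \<sigma> \<le> 0 + 1" and tv: "t \<in> simplex_on \<sigma>" "v \<in> \<sigma>" for \<sigma> t v
    proof -
      obtain w where "\<sigma> = {w}" using singleton[OF \<sigma>] by blast
      then show ?thesis using tv \<open>\<epsilon> > 0\<close> by (simp add: simplex_on_singleton r)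
    qed
    ultimately show "\<exists>r. continuous_on (skeleton \<K> 0) r \<and> (\<forall>v. {v} \<in> \<K> \<longrightarrow> r (vertex v) = r0 v) \<and>
           (\<forall>\<sigma>\<in>\<K>. card \<sigma> \<le> 0 + 1 \<longrightarrow> (\<forall>t\<in>simplex_on \<sigma>. \<forall>v\<in>\<sigma>. dist (r t) (r0 v) < \<epsilon>))"
      using r by blast
  qed
next
  case (Suc m)
  have e2: "\<epsilon> / 2 > 0" using \<open>\<epsilon> > 0\<close> by simp
  obtain \<delta> where "\<delta> > 0" and fill: "\<And>y :: 'a. sphere_fills m (ball y \<delta>) (ball y (\<epsilon> / 2))"
    using Suc.prems(1) e2 lessI by blast
  \<comment> \<open>A boundary point of \<open>\<sigma>\<close> lies in a face that may miss the vertex \<open>a \<sigma>\<close>; one half of \<open>\<delta>\<close> is for the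
    distance to a vertex of that face, the other half for the distance from there to \<open>a \<sigma>\<close>.\<close>
  define \<epsilon>' where "\<epsilon>' = min \<epsilon> (\<delta> / 2)"
  have "\<epsilon>' > 0" using \<open>\<delta> > 0\<close> \<open>\<epsilon> > 0\<close> by (simp add: \<epsilon>'_def)
  have fills_m: "\<forall>i<m. \<forall>\<epsilon>>0. \<exists>\<delta>>0. \<forall>y :: 'a. sphere_fills i (ball y \<delta>) (ball y \<epsilon>)"
    using Suc.prems(1) less_SucI by blast
  obtain \<eta>0 where "\<eta>0 > 0" and \<eta>0: "\<forall>\<K> (r0 :: 'v \<Rightarrow> 'a).
      complex_of_simplices \<K> \<and> (\<forall>\<sigma>\<in>\<K>. \<forall>v\<in>\<sigma>. \<forall>w\<in>\<sigma>. dist (r0 v) (r0 w) < \<eta>0) \<longrightarrow>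
      (\<exists>r. continuous_on (skeleton \<K> m) r \<and> (\<forall>v. {v} \<in> \<K> \<longrightarrow> r (vertex v) = r0 v) \<and>
           (\<forall>\<sigma>\<in>\<K>. card \<sigma> \<le> m + 1 \<longrightarrow> (\<forall>t\<in>simplex_on \<sigma>. \<forall>v\<in>\<sigma>. dist (r t) (r0 v) < \<epsilon>')))"
    using Suc.IH[OF fills_m \<open>\<epsilon>' > 0\<close>] by (elim exE conjE)
  define \<eta> where "\<eta> = min \<eta>0 (min (\<delta> / 2) (\<epsilon> / 2))"
  have "\<eta> > 0" using \<open>\<eta>0 > 0\<close> \<open>\<delta> > 0\<close> \<open>\<epsilon> > 0\<close> by (simp add: \<eta>_def)
  show ?case
  proof (intro exI[of _ \<eta>] conjI allI impI \<open>\<eta> > 0\<close>, elim conjE)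
    fix \<K> :: "'v set set" and r0 :: "'v \<Rightarrow> 'a"
    assume \<K>: "complex_of_simplices \<K>" and close: "\<forall>\<sigma>\<in>\<K>. \<forall>v\<in>\<sigma>. \<forall>w\<in>\<sigma>. dist (r0 v) (r0 w) < \<eta>"
    have "\<forall>\<sigma>\<in>\<K>. \<forall>v\<in>\<sigma>. \<forall>w\<in>\<sigma>. dist (r0 v) (r0 w) < \<eta>0" using close by (simp add: \<eta>_def)
    then obtain r where r: "continuous_on (skeleton \<K> m) r"
        "\<forall>v. {v} \<in> \<K> \<longrightarrow> r (vertex v) = r0 v"
        "\<forall>\<sigma>\<in>\<K>. card \<sigma> \<le> m + 1 \<longrightarrow> (\<forall>t\<in>simplex_on \<sigma>. \<forall>v\<in>\<sigma>. dist (r t) (r0 v) < \<epsilon>')"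
      using \<eta>0[rule_format, of \<K> r0] \<K> by blast
    define a where "a \<sigma> = (SOME v. v \<in> \<sigma>)" for \<sigma> :: "'v set"
    have props: "finite \<sigma>" "a \<sigma> \<in> \<sigma>" "\<And>\<tau>. \<tau> \<subseteq> \<sigma> \<Longrightarrow> \<tau> \<noteq> {} \<Longrightarrow> \<tau> \<in> \<K>" if \<sigma>: "\<sigma> \<in> \<K>" for \<sigma>
    proof -
      have *: "finite \<sigma>" "\<sigma> \<noteq> {}" "\<forall>\<tau>. \<tau> \<subseteq> \<sigma> \<and> \<tau> \<noteq> {} \<longrightarrow> \<tau> \<in> \<K>"
        using \<K> \<sigma> unfolding complex_of_simplices_def by blast+
      show "finite \<sigma>" "\<And>\<tau>. \<tau> \<subseteq> \<sigma> \<Longrightarrow> \<tau> \<noteq> {} \<Longrightarrow> \<tau> \<in> \<K>" using * by blast+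
      show "a \<sigma> \<in> \<sigma>" unfolding a_def using *(2) by (simp add: some_in_eq)
    qed
    have boundary: "t \<in> skeleton \<K> m \<and> dist (r t) (r0 (a \<sigma>)) < \<delta>"
      if \<sigma>: "\<sigma> \<in> \<K>" "card \<sigma> = m + 2" and t: "t \<in> simplex_boundary \<sigma>" for \<sigma> t
    proof -
      let ?\<tau> = "{v. t v \<noteq> 0}"
      have tS: "t \<in> simplex_on \<sigma>" using t by (simp add: simplex_boundary_def)
      note supp = simplex_on_support[OF tS props(1)[OF \<sigma>(1)]]
      have card: "card ?\<tau> \<le> m + 1"
        using simplex_boundary_iff[OF tS props(1)[OF \<sigma>(1)]] t \<sigma>(2) by simp
      have \<tau>: "?\<tau> \<in> \<K>" using props(3)[OF \<sigma>(1)] supp by blast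
      obtain w where w: "w \<in> ?\<tau>" using supp(2) by blast
      have "dist (r t) (r0 w) < \<epsilon>'" using r(3) \<tau> card supp(3) w by blast
      moreover have "dist (r0 w) (r0 (a \<sigma>)) < \<eta>"
        using close \<sigma>(1) w supp(1) props(2)[OF \<sigma>(1)] by blast
      ultimately have "dist (r t) (r0 (a \<sigma>)) < \<delta>"
        using dist_triangle[of "r t" "r0 (a \<sigma>)" "r0 w"] by (simp add: \<epsilon>'_def \<eta>_def)
      then show ?thesis using mem_skeleton_iff[OF \<K> \<sigma>(1) tS] card by simp
    qed
    have "\<exists>g. continuous_on (simplex_on \<sigma>) g \<and> g ` simplex_on \<sigma> \<subseteq> ball (r0 (a \<sigma>)) (\<epsilon> / 2) \<and>
        (\<forall>t\<in>simplex_boundary \<sigma>. g t = r t)" if \<sigma>: "\<sigma> \<in> \<K>" "card \<sigma> = m + 2" for \<sigma>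
    proof (rule sphere_fills_simplex[OF \<sigma>(2) fill[of "r0 (a \<sigma>)"]])
      show "continuous_on (simplex_boundary \<sigma>) r"
        using continuous_on_subset[OF r(1)] boundary[OF \<sigma>] by blast
      show "r ` simplex_boundary \<sigma> \<subseteq> ball (r0 (a \<sigma>)) \<delta>"
        using boundary[OF \<sigma>] by (auto simp: dist_commute)
    qed
    then obtain r' where r': "continuous_on (skeleton \<K> (Suc m)) r'"
        "\<forall>t\<in>skeleton \<K> m. r' t = r t"
        "\<forall>\<sigma>\<in>\<K>. card \<sigma> = m + 2 \<longrightarrow> r' ` simplex_on \<sigma> \<subseteq> ball (r0 (a \<sigma>)) (\<epsilon> / 2)"
      using extension_over_next_skeleton[OF \<K> r(1), of "\<lambda>\<sigma>. ball (r0 (a \<sigma>)) (\<epsilon> / 2)"] by blast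
    have skel: "t \<in> skeleton \<K> m" if "\<sigma> \<in> \<K>" "card \<sigma> \<le> m + 1" "t \<in> simplex_on \<sigma>" for \<sigma> t
      using that unfolding skeleton_def by blast
    have "r' (vertex v) = r0 v" if "{v} \<in> \<K>" for v
      using skel[OF that, of "vertex v"] r'(2) r(2) that by (simp add: simplex_on_singleton)
    moreover have "dist (r' t) (r0 v) < \<epsilon>"
      if \<sigma>: "\<sigma> \<in> \<K>" "card \<sigma> \<le> Suc m + 1" and t: "t \<in> simplex_on \<sigma>" and v: "v \<in> \<sigma>" for \<sigma> t v
    proof (cases "card \<sigma> \<le> m + 1")
      case True
      then have "dist (r t) (r0 v) < \<epsilon>'" using r(3) \<sigma>(1) t v by blast
      then show ?thesis using skel[OF \<sigma>(1) True t] r'(2) by (simp add: \<epsilon>'_def)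
    next
      case False
      then have "card \<sigma> = m + 2" using \<sigma>(2) by simp
      then have "r' t \<in> ball (r0 (a \<sigma>)) (\<epsilon> / 2)" using r'(3) \<sigma>(1) t by blast
      moreover have "dist (r0 (a \<sigma>)) (r0 v) < \<eta>" using close \<sigma>(1) v props(2)[OF \<sigma>(1)] by blast
      ultimately show ?thesis
        using dist_triangle[of "r' t" "r0 v" "r0 (a \<sigma>)"] by (simp add: \<eta>_def dist_commute)
    qed
    ultimately show "\<exists>r. continuous_on (skeleton \<K> (Suc m)) r \<and> (\<forall>v. {v} \<in> \<K> \<longrightarrow> r (vertex v) = r0 v) \<and>
           (\<forall>\<sigma>\<in>\<K>. card \<sigma> \<le> Suc m + 1 \<longrightarrow> (\<forall>t\<in>simplex_on \<sigma>. \<forall>v\<in>\<sigma>. dist (r t) (r0 v) < \<epsilon>))"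
      using r'(1) by blast
  qed
qed

section \<open>Finite-dimensional locally connected spaces are steerable\<close>

text \<open>
From a fine cover of order at most \<open>n + 1\<close>, every member except one chosen \<open>V p\<close> containing \<open>p\<close> loses
a small closed ball around \<open>p\<close>. Shrinking members does not increase the order; the removed points
are still covered by \<open>V p\<close>, because the balls around different points are disjoint.
\<close>
lemma separating_cover:
  fixes P :: "'a::metric_space set"
  assumes cpt: "compact (UNIV :: 'a set)" and dim: "covering_dim_le (euclidean :: 'a topology) n"
    and P: "finite P" and "\<beta> > 0"
  shows "\<exists>\<C> C. finite \<C> \<and> (\<forall>D\<in>\<C>. open D) \<and> \<Union>\<C> = UNIV \<and>
           (\<forall>D\<in>\<C>. \<forall>x\<in>D. \<forall>y\<in>D. dist x y < \<beta>) \<and> (\<forall>x. card {D\<in>\<C>. x \<in> D} \<le> n + 1) \<and> inj_on C P \<and>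
           (\<forall>p\<in>P. C p \<in> \<C> \<and> (\<exists>W. open W \<and> p \<in> W \<and> (\<forall>x\<in>W. \<forall>D\<in>\<C>. x \<in> D \<longrightarrow> D = C p)))"
proof -
  obtain r where r: "r > 0" "\<And>p q. p \<in> P \<Longrightarrow> q \<in> P \<Longrightarrow> p \<noteq> q \<Longrightarrow> cball p r \<inter> cball q r = {}"
    using finite_disjoint_cballs[OF P] by blast
  \<comment> \<open>The bound \<open>r\<close> on the mesh makes the sets \<open>V p\<close> different for different points of \<open>P\<close>.\<close>
  define \<rho> where "\<rho> = min r \<beta> / 2"
  have "\<rho> > 0" using r(1) \<open>\<beta> > 0\<close> by (simp add: \<rho>_def)
  then obtain K where K: "finite K" "(UNIV :: 'a set) \<subseteq> (\<Union>x\<in>K. ball x \<rho>)"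
    using seq_compact_imp_totally_bounded[OF compact_imp_seq_compact[OF cpt]] by blast
  let ?\<U> = "(\<lambda>x. ball x \<rho>) ` K"
  have "finite ?\<U> \<and> (\<forall>U\<in>?\<U>. openin euclidean U) \<and> \<Union>?\<U> = topspace euclidean"
    using K by auto
  from dim[unfolded covering_dim_le_def, rule_format, OF this]
  obtain \<V> where fin\<V>: "finite \<V>" and openV: "\<forall>V\<in>\<V>. open V" and cov: "\<Union>\<V> = (UNIV :: 'a set)"
    and ref: "\<forall>V\<in>\<V>. \<exists>U\<in>?\<U>. V \<subseteq> U" and ord: "\<forall>x. card {V\<in>\<V>. x \<in> V} \<le> n + 1"
    by auto
  have small: "dist x y < min r \<beta>" if V: "V \<in> \<V>" "x \<in> V" "y \<in> V" for V x y
  proof -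
    obtain z where "V \<subseteq> ball z \<rho>" using ref V(1) by blast
    then have "dist z x < \<rho>" "dist z y < \<rho>" using V by auto
    then have "dist x y < 2 * \<rho>" using dist_triangle3[of x y z] by linarith
    then show ?thesis by (simp add: \<rho>_def)
  qed
  have "\<exists>V. V \<in> \<V> \<and> p \<in> V" for p using cov by (metis UNIV_I UnionE)
  then obtain V where V: "\<And>p. V p \<in> \<V>" "\<And>p. p \<in> V p" by metis
  have V_eq: "p = q" if "p \<in> P" "q \<in> P" "V p = V q" for p q
  proof (rule ccontr)
    assume "p \<noteq> q"
    have "dist p q < r" using small[OF V(1)[of p] V(2)] V(2)[of q] that(3) by simp
    then have "q \<in> cball p r \<inter> cball q r" using r(1) by simp
    then show False using r(2)[OF that(1,2) \<open>p \<noteq> q\<close>] by blast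
  qed
  have "\<exists>s>0. cball p s \<subseteq> V p" for p
    using openV V open_contains_cball by blast
  then obtain s0 where s0: "\<And>p. s0 p > 0" "\<And>p. cball p (s0 p) \<subseteq> V p" by metis
  define s where "s p = min (s0 p) r" for p
  have s: "s p > 0" "cball p (s p) \<subseteq> V p" "cball p (s p) \<subseteq> cball p r" for p
  proof -
    show "s p > 0" using s0(1) r(1) by (simp add: s_def)
    have "cball p (s p) \<subseteq> cball p (s0 p)" by (simp add: s_def subset_cball)
    then show "cball p (s p) \<subseteq> V p" using s0(2) by blast
    show "cball p (s p) \<subseteq> cball p r" by (simp add: s_def subset_cball)
  qed
  define T where "T D = D - (\<Union>p\<in>{p\<in>P. V p \<noteq> D}. cball p (s p))" for D
  have T_sub: "T D \<subseteq> D" for D by (auto simp: T_def)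
  have T_unique: "D = V p" if "p \<in> P" "x \<in> cball p (s p)" "x \<in> T D" for p x D
    using that by (auto simp: T_def)
  have T_mem: "x \<in> T (V p)" if p: "p \<in> P" "x \<in> cball p (s p)" for p x
  proof -
    have "x \<notin> cball q (s q)" if q: "q \<in> P" "V q \<noteq> V p" for q
    proof
      assume "x \<in> cball q (s q)"
      then have "x \<in> cball q r" "x \<in> cball p r" using s(3) p(2) by blast+
      then show False using r(2)[OF q(1) p(1)] q(2) by blast
    qed
    moreover have "x \<in> V p" using p(2) s(2) by blast
    ultimately show ?thesis by (auto simp: T_def)
  qed
  have Tp: "p \<in> T (V p)" if "p \<in> P" for p
  proof -
    have "p \<in> cball p (s p)" using s(1)[of p] by simp
    then show ?thesis by (rule T_mem[OF that])
  qed
  show ?thesis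
  proof (intro exI[of _ "T ` \<V>"] exI[of _ "\<lambda>p. T (V p)"] conjI)
    show "finite (T ` \<V>)" using fin\<V> by simp
    show "\<forall>D\<in>T ` \<V>. open D"
      unfolding T_def using openV P by (auto intro!: open_Diff closed_UN)
    show "\<Union>(T ` \<V>) = UNIV"
    proof -
      have "\<exists>D\<in>\<V>. x \<in> T D" for x
      proof (cases "\<exists>p\<in>P. x \<in> cball p (s p)")
        case True
        then show ?thesis using T_mem V(1) by blast
      next
        case False
        then have "x \<in> T (V x)" using V(2)[of x] unfolding T_def by blast
        then show ?thesis using V(1) by blast
      qed
      then show ?thesis by blast
    qed
    show "\<forall>D\<in>T ` \<V>. \<forall>x\<in>D. \<forall>y\<in>D. dist x y < \<beta>"
    proof safe
      fix D x y assume "D \<in> \<V>" "x \<in> T D" "y \<in> T D"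
      then show "dist x y < \<beta>" using small[of D x y] T_sub[of D] by auto
    qed
    show "\<forall>x. card {D \<in> T ` \<V>. x \<in> D} \<le> n + 1"
    proof
      fix x
      have "{D \<in> T ` \<V>. x \<in> D} \<subseteq> T ` {D\<in>\<V>. x \<in> D}" using T_sub by blast
      then have "card {D \<in> T ` \<V>. x \<in> D} \<le> card {D\<in>\<V>. x \<in> D}"
        using fin\<V> by (intro surj_card_le) auto
      then show "card {D \<in> T ` \<V>. x \<in> D} \<le> n + 1" using ord le_trans by blast
    qed
    show "inj_on (\<lambda>p. T (V p)) P"
    proof (rule inj_onI)
      fix p q assume pq: "p \<in> P" "q \<in> P" "T (V p) = T (V q)"
      have "p \<in> cball p (s p)" using s(1)[of p] by simp
      moreover have "p \<in> T (V q)" using Tp[OF pq(1)] unfolding pq(3) .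
      ultimately have "V q = V p" by (rule T_unique[OF pq(1)])
      then show "p = q" using V_eq[OF pq(1,2)] by simp
    qed
    show "\<forall>p\<in>P. T (V p) \<in> T ` \<V> \<and>
        (\<exists>W. open W \<and> p \<in> W \<and> (\<forall>x\<in>W. \<forall>D\<in>T ` \<V>. x \<in> D \<longrightarrow> D = T (V p)))"
    proof
      fix p assume p: "p \<in> P"
      have "D = T (V p)" if "x \<in> ball p (s p)" "D \<in> T ` \<V>" "x \<in> D" for x D
      proof -
        have "x \<in> cball p (s p)" using that(1) by simp
        then show ?thesis using T_unique[OF p] that(2,3) by blast
      qed
      moreover have "open (ball p (s p))" "p \<in> ball p (s p)" using s(1)[of p] by simp_all
      ultimately show "T (V p) \<in> T ` \<V> \<and>
          (\<exists>W. open W \<and> p \<in> W \<and> (\<forall>x\<in>W. \<forall>D\<in>T ` \<V>. x \<in> D \<longrightarrow> D = T (V p)))"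
        using V(1) by blast
    qed
  qed
qed

text \<open>
A partition of unity subordinate to \<open>\<C>\<close>, read as a map into the nerve of \<open>\<C>\<close> in barycentric
coordinates.
\<close>
lemma barycentric_map:
  fixes \<C> :: "'a::metric_space set set"
  assumes "finite \<C>" "\<forall>D\<in>\<C>. open D" "\<Union>\<C> = UNIV"
  shows "\<exists>\<phi> :: 'a \<Rightarrow> 'a set \<Rightarrow> real. continuous_on UNIV \<phi> \<and>
           (\<forall>x. \<phi> x \<in> simplex_on {D\<in>\<C>. x \<in> D})"
proof -
  have cov: "UNIV \<subseteq> \<Union>\<C>" using assms(3) by blast
  have "\<exists>F :: 'a set \<Rightarrow> 'a \<Rightarrow> real. (\<forall>D\<in>\<C>. continuous_on UNIV (F D) \<and> (\<forall>x. 0 \<le> F D x)) \<and>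
      (\<forall>D\<in>\<C>. \<forall>x. x \<notin> D \<longrightarrow> F D x = 0) \<and> (\<forall>x. supp_sum (\<lambda>D. F D x) \<C> = 1)"
  proof (rule subordinate_partition_of_unity[OF cov])
    show "open T" if "T \<in> \<C>" for T using assms(2) that by blast
    show "\<exists>V. open V \<and> x \<in> V \<and> finite {U \<in> \<C>. U \<inter> V \<noteq> {}}" for x
      using assms(1) by (intro exI[of _ UNIV]) simp
    fix F :: "'a set \<Rightarrow> 'a \<Rightarrow> real"
    assume "\<And>U. U \<in> \<C> \<Longrightarrow> continuous_on UNIV (F U) \<and> (\<forall>x\<in>UNIV. 0 \<le> F U x)"
      "\<And>x U. U \<in> \<C> \<Longrightarrow> x \<in> UNIV \<Longrightarrow> x \<notin> U \<Longrightarrow> F U x = 0"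
      "\<And>x. x \<in> UNIV \<Longrightarrow> supp_sum (\<lambda>W. F W x) \<C> = 1"
    then show ?thesis by (intro exI[of _ F]) simp
  qed
  then obtain F :: "'a set \<Rightarrow> 'a \<Rightarrow> real"
    where F: "\<forall>D\<in>\<C>. continuous_on UNIV (F D) \<and> (\<forall>x. 0 \<le> F D x)"
      "\<forall>D\<in>\<C>. \<forall>x. x \<notin> D \<longrightarrow> F D x = 0" "\<forall>x. supp_sum (\<lambda>D. F D x) \<C> = 1"
    by (elim exE conjE)
  define \<phi> where "\<phi> x D = (if D \<in> \<C> then F D x else 0)" for x D
  have "continuous_on UNIV (\<lambda>x. \<phi> x D)" for D
    using F(1) by (cases "D \<in> \<C>") (auto simp: \<phi>_def)
  then have "continuous_on UNIV \<phi>" by (rule continuous_on_coordinatewise_then_product)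
  moreover have "\<phi> x \<in> simplex_on {D\<in>\<C>. x \<in> D}" for x
  proof -
    have "1 = (\<Sum>D\<in>\<C>. F D x)"
    proof -
      have "1 = (\<Sum>D\<in>{D\<in>\<C>. F D x \<noteq> 0}. F D x)"
        using F(3) unfolding supp_sum_def support_on_def by simp
      also have "\<dots> = (\<Sum>D\<in>\<C>. F D x)"
        using assms(1) by (intro sum.mono_neutral_left) auto
      finally show ?thesis .
    qed
    also have "\<dots> = sum (\<phi> x) \<C>" by (intro sum.cong) (simp_all add: \<phi>_def)
    also have "\<dots> = sum (\<phi> x) {D\<in>\<C>. x \<in> D}"
      using F(2) assms(1) by (intro sum.mono_neutral_right) (auto simp: \<phi>_def)
    finally have "sum (\<phi> x) {D\<in>\<C>. x \<in> D} = 1" by simp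
    then show ?thesis using F(1,2) by (auto simp: simplex_on_def \<phi>_def)
  qed
  ultimately show ?thesis by blast
qed

text \<open>
The steered map is \<open>r \<circ> \<phi>\<close>, where \<open>\<phi>\<close> maps \<open>X\<close> to the nerve \<open>\<K>\<close> of a separating cover and \<open>r\<close> is
a realization of the nerve in \<open>X\<close>. On the vertices, \<open>r\<close> is given by \<open>r0\<close>, which takes the
prescribed value \<open>q p\<close> at the vertex \<open>C p\<close> and follows \<open>f\<close> elsewhere.
\<close>
lemma steerable_if_dim_LC:
  assumes cpt: "compact (UNIV :: 'a::metric_space set)"
    and dim: "covering_dim_le (euclidean :: 'a topology) n"
    and LC: "LC_space (int n - 1) (euclidean :: 'a topology)"
  shows "steerable TYPE('a)"
  unfolding steerable_def
proof (intro allI impI)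
  fix \<epsilon> :: real assume "\<epsilon> > 0"
  then have e2: "\<epsilon> / 2 > 0" by simp
  have fills: "\<forall>i<n. \<forall>\<epsilon>>0. \<exists>\<delta>>0. \<forall>y :: 'a. sphere_fills i (ball y \<delta>) (ball y \<epsilon>)"
  proof (intro allI impI)
    fix i and \<epsilon> :: real assume "i < n" "\<epsilon> > 0"
    then show "\<exists>\<delta>>0. \<forall>y :: 'a. sphere_fills i (ball y \<delta>) (ball y \<epsilon>)"
      using LC_space_uniform[OF cpt LC \<open>\<epsilon> > 0\<close>] by force
  qed
  obtain \<eta> where "\<eta> > 0" and \<eta>: "\<forall>\<K> (r0 :: 'a set \<Rightarrow> 'a).
      complex_of_simplices \<K> \<and> (\<forall>\<sigma>\<in>\<K>. \<forall>v\<in>\<sigma>. \<forall>w\<in>\<sigma>. dist (r0 v) (r0 w) < \<eta>) \<longrightarrow>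
      (\<exists>r. continuous_on (skeleton \<K> n) r \<and> (\<forall>v. {v} \<in> \<K> \<longrightarrow> r (vertex v) = r0 v) \<and>
           (\<forall>\<sigma>\<in>\<K>. card \<sigma> \<le> n + 1 \<longrightarrow> (\<forall>t\<in>simplex_on \<sigma>. \<forall>v\<in>\<sigma>. dist (r t) (r0 v) < \<epsilon> / 2)))"
    using skeleton_realization[OF fills e2] by (elim exE conjE)
  \<comment> \<open>For \<open>x \<in> D\<close>, the value \<open>r0 D\<close> is \<open>2 * \<delta>\<close>-close to \<open>f x\<close>, so adjacent vertices have
    \<open>4 * \<delta>\<close>-close images.\<close>
  define \<delta> where "\<delta> = min (\<eta> / 4) (\<epsilon> / 4)"
  have "\<delta> > 0" using \<open>\<eta> > 0\<close> \<open>\<epsilon> > 0\<close> by (simp add: \<delta>_def)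
  show "\<exists>\<delta>>0. \<forall>(f :: 'a \<Rightarrow> 'a) P q.
        continuous_on UNIV f \<and> finite P \<and> (\<forall>p\<in>P. dist (f p) (q p) < \<delta>) \<longrightarrow>
        (\<exists>g. continuous_on UNIV g \<and> (\<forall>x. dist (g x) (f x) < \<epsilon>) \<and>
             (\<forall>p\<in>P. \<exists>W. open W \<and> p \<in> W \<and> (\<forall>x\<in>W. g x = q p)))"
  proof (intro exI[of _ \<delta>] conjI allI impI \<open>\<delta> > 0\<close>, elim conjE)
    fix f q :: "'a \<Rightarrow> 'a" and P
    assume f: "continuous_on UNIV f" and P: "finite P" "\<forall>p\<in>P. dist (f p) (q p) < \<delta>"
    have "uniformly_continuous_on UNIV f" by (rule compact_uniformly_continuous[OF f cpt])
    then obtain \<beta> where \<beta>: "\<beta> > 0" "\<And>x y. dist x y < \<beta> \<Longrightarrow> dist (f x) (f y) < \<delta>"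
      using \<open>\<delta> > 0\<close> unfolding uniformly_continuous_on_def by (metis UNIV_I)
    obtain \<C> C where \<C>: "finite \<C>" "\<forall>D\<in>\<C>. open D" "\<Union>\<C> = (UNIV :: 'a set)"
      and small: "\<forall>D\<in>\<C>. \<forall>x\<in>D. \<forall>y\<in>D. dist x y < \<beta>" and ord: "\<forall>x. card {D\<in>\<C>. x \<in> D} \<le> n + 1"
      and C: "inj_on C P"
        "\<forall>p\<in>P. C p \<in> \<C> \<and> (\<exists>W. open W \<and> p \<in> W \<and> (\<forall>x\<in>W. \<forall>D\<in>\<C>. x \<in> D \<longrightarrow> D = C p))"
      using separating_cover[OF cpt dim P(1) \<beta>(1)] by (elim exE conjE)
    obtain \<phi> where \<phi>: "continuous_on UNIV \<phi>" "\<And>x. \<phi> x \<in> simplex_on {D\<in>\<C>. x \<in> D}"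
      using barycentric_map[OF \<C>] by blast
    define \<K> where "\<K> = {\<sigma>. \<sigma> \<subseteq> \<C> \<and> \<sigma> \<noteq> {} \<and> \<Inter>\<sigma> \<noteq> {}}"
    have nerve: "{D\<in>\<C>. x \<in> D} \<in> \<K>" for x
    proof -
      obtain D where "D \<in> \<C>" "x \<in> D" using \<C>(3) by (metis UNIV_I UnionE)
      then show ?thesis unfolding \<K>_def by blast
    qed
    have "complex_of_simplices \<K>"
      unfolding complex_of_simplices_def
    proof (intro conjI ballI allI impI)
      show "finite \<K>" by (rule finite_subset[of _ "Pow \<C>"]) (auto simp: \<K>_def \<C>(1))
      fix \<sigma> assume \<sigma>: "\<sigma> \<in> \<K>"
      show "finite \<sigma>" using \<sigma> \<C>(1) finite_subset unfolding \<K>_def by blast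
      show "\<sigma> \<noteq> {}" using \<sigma> unfolding \<K>_def by blast
      fix \<tau> assume "\<tau> \<subseteq> \<sigma> \<and> \<tau> \<noteq> {}"
      then show "\<tau> \<in> \<K>" using \<sigma> unfolding \<K>_def by blast
    qed
    define r0 where "r0 D = (if D \<in> C ` P then q (inv_into P C D) else f (SOME x. x \<in> D))" for D
    have r0_C: "r0 (C p) = q p" if "p \<in> P" for p
      using that inv_into_f_f[OF C(1) that] by (simp add: r0_def)
    have C_mem: "p \<in> C p" if p: "p \<in> P" for p
    proof -
      obtain W where W: "p \<in> W" "\<forall>x\<in>W. \<forall>D\<in>\<C>. x \<in> D \<longrightarrow> D = C p" using C(2) p by blast
      obtain D where "D \<in> \<C>" "p \<in> D" using \<C>(3) by (metis UNIV_I UnionE)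
      then show ?thesis using W by blast
    qed
    have r0_close: "dist (r0 D) (f x) < 2 * \<delta>" if D: "D \<in> \<C>" "x \<in> D" for D x
    proof (cases "D \<in> C ` P")
      case True
      then obtain p where p: "p \<in> P" "D = C p" by blast
      have "dist p x < \<beta>" using small D C_mem[OF p(1)] p(2) by blast
      then have "dist (f p) (f x) < \<delta>" by (rule \<beta>(2))
      moreover have "dist (f p) (q p) < \<delta>" using P(2) p(1) by blast
      ultimately show ?thesis
        using dist_triangle3[of "q p" "f x" "f p"] r0_C[OF p(1)] p(2) by simp
    next
      case False
      have "(SOME x. x \<in> D) \<in> D" using D(2) by (rule someI)
      then have "dist (SOME x. x \<in> D) x < \<beta>" using small D by blast
      then have "dist (r0 D) (f x) < \<delta>" using \<beta>(2) False by (simp add: r0_def)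
      then show ?thesis using \<open>\<delta> > 0\<close> by simp
    qed
    have "dist (r0 D) (r0 E) < \<eta>" if \<sigma>: "\<sigma> \<in> \<K>" "D \<in> \<sigma>" "E \<in> \<sigma>" for \<sigma> D E
    proof -
      obtain x where x: "x \<in> D" "x \<in> E" "D \<in> \<C>" "E \<in> \<C>" using \<sigma> unfolding \<K>_def by blast
      have "dist (r0 D) (r0 E) < 4 * \<delta>"
        using r0_close[OF x(3,1)] r0_close[OF x(4,2)] dist_triangle2[of "r0 D" "r0 E" "f x"] by simp
      then show ?thesis by (simp add: \<delta>_def)
    qed
    then obtain r where r: "continuous_on (skeleton \<K> n) r" "\<forall>D. {D} \<in> \<K> \<longrightarrow> r (vertex D) = r0 D"
      "\<forall>\<sigma>\<in>\<K>. card \<sigma> \<le> n + 1 \<longrightarrow> (\<forall>t\<in>simplex_on \<sigma>. \<forall>v\<in>\<sigma>. dist (r t) (r0 v) < \<epsilon> / 2)"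
      using \<eta>[rule_format, of \<K> r0] \<open>complex_of_simplices \<K>\<close> by blast
    have "\<phi> x \<in> skeleton \<K> n" for x
      using \<phi>(2)[of x] nerve[of x] ord unfolding skeleton_def by blast
    then have "continuous_on UNIV (r \<circ> \<phi>)"
      by (intro continuous_on_compose[OF \<phi>(1)] continuous_on_subset[OF r(1)]) blast
    moreover have "dist ((r \<circ> \<phi>) x) (f x) < \<epsilon>" for x
    proof -
      obtain D where D: "D \<in> \<C>" "x \<in> D" using \<C>(3) by (metis UNIV_I UnionE)
      have "dist (r (\<phi> x)) (r0 D) < \<epsilon> / 2" using r(3) nerve[of x] ord \<phi>(2)[of x] D by blast
      moreover have "dist (r0 D) (f x) < \<epsilon> / 2" using r0_close[OF D] by (simp add: \<delta>_def)
      ultimately show ?thesis using dist_triangle[of "r (\<phi> x)" "f x" "r0 D"] by simp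
    qed
    moreover have "\<exists>W. open W \<and> p \<in> W \<and> (\<forall>x\<in>W. (r \<circ> \<phi>) x = q p)" if p: "p \<in> P" for p
    proof -
      obtain W where W: "open W" "p \<in> W" "\<forall>x\<in>W. \<forall>D\<in>\<C>. x \<in> D \<longrightarrow> D = C p" using C(2) p by blast
      have "(r \<circ> \<phi>) x = q p" if "x \<in> W" for x
      proof -
        obtain D where "D \<in> \<C>" "x \<in> D" using \<C>(3) by (metis UNIV_I UnionE)
        then have eq: "{D\<in>\<C>. x \<in> D} = {C p}" using W(3) \<open>x \<in> W\<close> by blast
        have "{C p} \<in> \<K>" using nerve[of x] unfolding eq .
        moreover have "\<phi> x = vertex (C p)" using \<phi>(2)[of x] unfolding eq simplex_on_singleton by simp
        ultimately show ?thesis using r(2) r0_C[OF p] by simp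
      qed
      then show ?thesis using W by blast
    qed
    ultimately show "\<exists>g. continuous_on UNIV g \<and> (\<forall>x. dist (g x) (f x) < \<epsilon>) \<and>
             (\<forall>p\<in>P. \<exists>W. open W \<and> p \<in> W \<and> (\<forall>x\<in>W. g x = q p))"
      by blast
  qed
qed

section \<open>Generic chain recurrent sets\<close>

theorem theorem6p6:
  assumes "compact (UNIV :: 'a::metric_space set)"
    and "perfect_set (UNIV :: 'a set)"
    and "ANR_space (euclidean :: 'a topology) \<or>
         (\<exists>n::nat. has_covering_dim (euclidean :: 'a topology) n \<and>
                   LC_space (int n - 1) (euclidean :: 'a topology))"
  shows "residual {f :: 'a \<Rightarrow>\<^sub>C 'a. perfect_set (CR (apply_bcontfun f))} \<and>
         (wLPPP TYPE('a) \<longrightarrow>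
           (\<forall>l\<ge>2. residual {f :: 'a \<Rightarrow>\<^sub>C 'a.
              perfect_set (CR (apply_bcontfun f)) \<and>
              closure (Per_ge l (apply_bcontfun f)) = CR (apply_bcontfun f)}))"
proof (rule generic_CR_of_steerable[OF assms(1,2)])
  show "steerable TYPE('a)"
    using assms(3)
  proof
    assume "ANR_space (euclidean :: 'a topology)"
    then show ?thesis
      by (intro steerable_if_locally_equiconnected ANR_space_locally_equiconnected assms(1))
  next
    assume "\<exists>n::nat. has_covering_dim (euclidean :: 'a topology) n \<and>
        LC_space (int n - 1) (euclidean :: 'a topology)"
    then show ?thesis
      using steerable_if_dim_LC[OF assms(1)] unfolding has_covering_dim_def by blast
  qed
qed

end
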